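(* Let $\mathbf Y$ be a collection of metric graphs with projections $\{\pi_Y\}$ and constant $\theta$ as in the context, let $K\ge4\theta$, and let $\mathcal C_K(\mathbf Y)$ be the associated quasi-tree of metric spaces. Suppose every $Y\in\mathbf Y$ satisfies the bottleneck property with a uniform constant $D$. Then $\mathcal C_K(\mathbf Y)$ is a quasi-tree.
   Context: Setting. $\mathbf Y=\{(Y,\rho_Y)\}$ is a collection of connected graphs, each with its path metric with edges of length one. For all $X\ne Y$ in $\mathbf Y$ there is a nonempty set of vertices $\pi_Y(X)\subseteq Y$, and $d_Y(X,Z)=\operatorname{diam}(\pi_Y(X)\cup\pi_Y(Z))$ for $X,Z\in\mathbf Y\setminus\{Y\}$. There is an integer $\theta\ge0$ such that: - $d_Y(X,X)\le\theta$ for $X\neq Y$; - (P1') for pairwise distinct $X,Y,Z$: if $d_Y(X,Z)>\theta$ then $\pi_X(Y)=\pi_X(Z)$; - for all $X,Z\in\mathbf Y$ the set $\{Y\in\mathbf Y\setminus\{X,Z\}:d_Y(X,Z)>\theta\}$ is finite. (Consequently $d_Y$ is symmetric, satisfies the triangle inequality, and if $d_Y(X,Z)>\theta$ then $d_Z(X,W)=d_Z(Y,W)$ for all $W\ne Z$.) $K>0$ is an integer. $\mathcal P_K(\mathbf Y)$ is the graph with vertex set $\mathbf Y$ with distinct $X,Z$ adjacent iff $d_Y(X,Z)\le K$ for all $Y\in\mathbf Y\setminus\{X,Z\}$. The quasi-tree of metric spaces $\mathcal C_K(\mathbf Y)$ is obtained from the disjoint union of the graphs in $\mathbf Y$ by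 adding, for each pair $X,Y$ adjacent in $\mathcal P_K(\mathbf Y)$, an edge of length $K$ connecting every point of $\pi_Y(X)$ to every point of $\pi_X(Y)$; it carries the induced path metric. Bottleneck property with constant $D\ge0$ for a connected graph $X$: for all vertices $v_0,v_1$ of $X$ there is a path $p$ from $v_0$ to $v_1$ such that the $D$-neighborhood of any path from $v_0$ to $v_1$ contains $p$. A quasi-tree is a geodesic metric space quasi-isometric to a tree. *)

theory Defs
  imports "HOL-Analysis.Analysis"
begin

section \<open>Graphs and their metric realizations\<close>

text \<open>Loops and multiple edges are allowed. Graphs are undirected: the order of the two end points
  of an edge is only used to parametrize that edge in the metric realization.\<close>

record ('v, 'e) graph =
  verts :: "'v set"
  edges :: "'e set"
  ends :: "'e \<Rightarrow> 'v \<times> 'v"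

definition wf_graph :: "('v, 'e) graph \<Rightarrow> bool" where
  "wf_graph G \<longleftrightarrow> (\<forall>e\<in>edges G. ends G e \<in> verts G \<times> verts G)"

text \<open>An edge path is the list of the edges traversed, each one in either direction.\<close>

primrec walk :: "('v, 'e) graph \<Rightarrow> 'v \<Rightarrow> 'e list \<Rightarrow> 'v \<Rightarrow> bool" where
  "walk G u [] v \<longleftrightarrow> u \<in> verts G \<and> u = v"
| "walk G u (e # w) v \<longleftrightarrow>
     e \<in> edges G \<and> (\<exists>u'. (ends G e = (u, u') \<or> ends G e = (u', u)) \<and> walk G u' w v)"

definition connected_graph :: "('v, 'e) graph \<Rightarrow> bool" where
  "connected_graph G \<longleftrightarrow> wf_graph G \<and> (\<forall>u\<in>verts G. \<forall>v\<in>verts G. \<exists>w. walk G u w v)"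

text \<open>A graph contains a cycle (including loops and pairs of parallel edges) iff it contains a
  nonempty closed edge path without repeated edges.\<close>

definition tree_graph :: "('v, 'e) graph \<Rightarrow> bool" where
  "tree_graph T \<longleftrightarrow> connected_graph T \<and> \<not> (\<exists>v w. w \<noteq> [] \<and> distinct w \<and> walk T v w v)"

text \<open>Points of the metric realization of a graph with edge lengths \<open>len\<close>: the point
  \<open>Inner e t\<close> lies in the open edge \<open>e\<close>, at distance \<open>t\<close> along \<open>e\<close> from its first end point.\<close>

datatype ('v, 'e) pt = Vert 'v | Inner 'e real

definition points :: "('v, 'e) graph \<Rightarrow> ('e \<Rightarrow> real) \<Rightarrow> ('v, 'e) pt set" where
  "points G len = Vert ` verts G \<union> {Inner e t | e t. e \<in> edges G \<and> 0 < t \<and> t < len e}"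

text \<open>The path metric takes values in \<open>[0, \<infinity>]\<close>; points in different components are at
  distance \<open>\<infinity>\<close>.\<close>

definition vert_dist :: "('v, 'e) graph \<Rightarrow> ('e \<Rightarrow> real) \<Rightarrow> 'v \<Rightarrow> 'v \<Rightarrow> ennreal" where
  "vert_dist G len u v = (INF w\<in>{w. walk G u w v}. ennreal (sum_list (map len w)))"

text \<open>The vertices first met when leaving a point along its edge, with the distance travelled.\<close>

primrec exits :: "('v, 'e) graph \<Rightarrow> ('e \<Rightarrow> real) \<Rightarrow> ('v, 'e) pt \<Rightarrow> ('v \<times> real) set" where
  "exits G len (Vert v) = {(v, 0)}"
| "exits G len (Inner e t) = {(fst (ends G e), t), (snd (ends G e), len e - t)}"

fun within_edge_dist :: "('v, 'e) pt \<Rightarrow> ('v, 'e) pt \<Rightarrow> ennreal" where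
  "within_edge_dist (Inner e s) (Inner f t) = (if e = f then ennreal \<bar>s - t\<bar> else top)"
| "within_edge_dist _ _ = top"

text \<open>A path between two points either stays inside one open edge or passes through vertices.\<close>

definition path_edist ::
  "('v, 'e) graph \<Rightarrow> ('e \<Rightarrow> real) \<Rightarrow> ('v, 'e) pt \<Rightarrow> ('v, 'e) pt \<Rightarrow> ennreal" where
  "path_edist G len x y = min (within_edge_dist x y)
     (INF (u, r)\<in>exits G len x. INF (v, s)\<in>exits G len y.
        ennreal r + vert_dist G len u v + ennreal s)"

text \<open>As \<open>enn2real top = 0\<close>, this is not a metric on \<open>points G len\<close> if \<open>G\<close> is disconnected.\<close>

definition path_dist ::
  "('v, 'e) graph \<Rightarrow> ('e \<Rightarrow> real) \<Rightarrow> ('v, 'e) pt \<Rightarrow> ('v, 'e) pt \<Rightarrow> real" where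
  "path_dist G len x y = enn2real (path_edist G len x y)"

abbreviation unit_len :: "'e \<Rightarrow> real" where
  "unit_len \<equiv> (\<lambda>_. 1)"

section \<open>The bottleneck property\<close>

text \<open>The subset of the unit-length realization covered by an edge path \<open>w\<close> starting at \<open>u\<close>.\<close>

definition walk_points :: "('v, 'e) graph \<Rightarrow> 'v \<Rightarrow> 'e list \<Rightarrow> ('v, 'e) pt set" where
  "walk_points G u w = {Vert u} \<union>
     (\<Union>e\<in>set w. {Vert (fst (ends G e)), Vert (snd (ends G e))} \<union> {Inner e t | t. 0 < t \<and> t < 1})"

definition bottleneck :: "real \<Rightarrow> ('v, 'e) graph \<Rightarrow> bool" where
  "bottleneck D G \<longleftrightarrow>
     (\<forall>v0\<in>verts G. \<forall>v1\<in>verts G. \<exists>p. walk G v0 p v1 \<and>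
        (\<forall>q. walk G v0 q v1 \<longrightarrow>
           (\<forall>x\<in>walk_points G v0 p. \<exists>y\<in>walk_points G v0 q. path_edist G unit_len x y \<le> ennreal D)))"

section \<open>Quasi-trees\<close>

definition geodesic_space :: "'a set \<Rightarrow> ('a \<Rightarrow> 'a \<Rightarrow> real) \<Rightarrow> bool" where
  "geodesic_space M d \<longleftrightarrow> Metric_space M d \<and>
     (\<forall>x\<in>M. \<forall>y\<in>M. \<exists>\<gamma>. \<gamma> ` {0..d x y} \<subseteq> M \<and> \<gamma> 0 = x \<and> \<gamma> (d x y) = y \<and>
        (\<forall>s\<in>{0..d x y}. \<forall>t\<in>{0..d x y}. d (\<gamma> s) (\<gamma> t) = \<bar>s - t\<bar>))"

definition quasi_isometry ::
  "'a set \<Rightarrow> ('a \<Rightarrow> 'a \<Rightarrow> real) \<Rightarrow> 'b set \<Rightarrow> ('b \<Rightarrow> 'b \<Rightarrow> real) \<Rightarrow> ('a \<Rightarrow> 'b) \<Rightarrow> bool" where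
  "quasi_isometry M d N d' f \<longleftrightarrow> f ` M \<subseteq> N \<and>
     (\<exists>L\<ge>1. \<exists>C\<ge>0.
        (\<forall>x\<in>M. \<forall>y\<in>M. d x y / L - C \<le> d' (f x) (f y) \<and> d' (f x) (f y) \<le> L * d x y + C) \<and>
        (\<forall>z\<in>N. \<exists>x\<in>M. d' (f x) z \<le> C))"

text \<open>Trees are simplicial trees with edges of length one. HOL cannot quantify over types, so the
  vertices of the tree are taken from the type \<open>nat \<times> 'a set\<close>. This loses nothing: if \<open>M\<close> is
  quasi-isometric to some tree, it is also quasi-isometric to the subtree spanned by the image of a
  separated net in \<open>M\<close> if the net is infinite, or to a single vertex if it is finite, and these have
  at most as many vertices and edges as the types chosen here have elements.\<close>

definition quasi_tree :: "'a set \<Rightarrow> ('a \<Rightarrow> 'a \<Rightarrow> real) \<Rightarrow> bool" where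
  "quasi_tree M d \<longleftrightarrow> geodesic_space M d \<and>
     (\<exists>(T :: (nat \<times> 'a set, (nat \<times> 'a set) \<times> (nat \<times> 'a set)) graph) f.
        tree_graph T \<and> quasi_isometry M d (points T unit_len) (path_dist T unit_len) f)"

section \<open>Projections and quasi-trees of metric spaces\<close>

text \<open>The collection of graphs is a family \<open>(G Y)\<close> indexed by a set \<open>I\<close>, and \<open>proj Y X\<close> is the
  projection of \<open>X\<close> to \<open>Y\<close>. The diameter, and hence \<open>proj_dist G proj Y X Z\<close>, may be \<open>\<infinity>\<close>.\<close>

definition proj_dist ::
  "('i \<Rightarrow> ('v, 'e) graph) \<Rightarrow> ('i \<Rightarrow> 'i \<Rightarrow> 'v set) \<Rightarrow> 'i \<Rightarrow> 'i \<Rightarrow> 'i \<Rightarrow> ennreal" where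
  "proj_dist G proj Y X Z =
     (SUP x\<in>proj Y X \<union> proj Y Z. SUP z\<in>proj Y X \<union> proj Y Z. vert_dist (G Y) unit_len x z)"

locale graph_projections =
  fixes I :: "'i set"
    and G :: "'i \<Rightarrow> ('v, 'e) graph"
    and proj :: "'i \<Rightarrow> 'i \<Rightarrow> 'v set"
    and \<theta> :: nat
  assumes connected: "Y \<in> I \<Longrightarrow> connected_graph (G Y)"
    and proj_verts: "\<lbrakk>X \<in> I; Y \<in> I; X \<noteq> Y\<rbrakk> \<Longrightarrow> proj Y X \<noteq> {} \<and> proj Y X \<subseteq> verts (G Y)"
    and proj_bounded: "\<lbrakk>X \<in> I; Y \<in> I; X \<noteq> Y\<rbrakk> \<Longrightarrow> proj_dist G proj Y X X \<le> of_nat \<theta>"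
    and proj_eq: "\<lbrakk>X \<in> I; Y \<in> I; Z \<in> I; X \<noteq> Y; Y \<noteq> Z; X \<noteq> Z; proj_dist G proj Y X Z > of_nat \<theta>\<rbrakk>
      \<Longrightarrow> proj X Y = proj X Z"
    and proj_finite: "\<lbrakk>X \<in> I; Z \<in> I\<rbrakk>
      \<Longrightarrow> finite {Y \<in> I - {X, Z}. proj_dist G proj Y X Z > of_nat \<theta>}"

definition PK_adj ::
  "'i set \<Rightarrow> ('i \<Rightarrow> ('v, 'e) graph) \<Rightarrow> ('i \<Rightarrow> 'i \<Rightarrow> 'v set) \<Rightarrow> nat \<Rightarrow> 'i \<Rightarrow> 'i \<Rightarrow> bool" where
  "PK_adj I G proj K X Z \<longleftrightarrow> X \<in> I \<and> Z \<in> I \<and> X \<noteq> Z \<and>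
     (\<forall>Y\<in>I - {X, Z}. proj_dist G proj Y X Z \<le> of_nat K)"

text \<open>The added edges are the unordered pairs of the vertices they join, so that there is exactly one
  edge for each such pair; its parametrization is chosen arbitrarily.\<close>

definition CK ::
  "'i set \<Rightarrow> ('i \<Rightarrow> ('v, 'e) graph) \<Rightarrow> ('i \<Rightarrow> 'i \<Rightarrow> 'v set) \<Rightarrow> nat
    \<Rightarrow> ('i \<times> 'v, ('i \<times> 'e) + ('i \<times> 'v) set) graph" where
  "CK I G proj K =
     \<lparr>verts = (SIGMA Y:I. verts (G Y)),
      edges = Inl ` (SIGMA Y:I. edges (G Y)) \<union>
        {Inr {(X, x), (Y, y)} | X Y x y. PK_adj I G proj K X Y \<and> x \<in> proj X Y \<and> y \<in> proj Y X},
      ends = case_sum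
        (\<lambda>(Y, e). map_prod (Pair Y) (Pair Y) (ends (G Y) e))
        (\<lambda>b. SOME p. b = {fst p, snd p})\<rparr>"

definition CK_len :: "nat \<Rightarrow> ('i \<times> 'e) + ('i \<times> 'v) set \<Rightarrow> real" where
  "CK_len K = case_sum (\<lambda>_. 1) (\<lambda>_. real K)"

end

theory Submission
  imports Defs
begin

text \<open>
  For a graph with a vertex chosen as root, let the vertices of a tree be the pairs of a level \<open>n\<close> and
  a component of the set of vertices at distance at least \<open>n\<close> from the root. If the graph has the
  bottleneck property, two vertices of the same component that lie near level \<open>n\<close> are a bounded
  distance apart, so sending a vertex to its component at its own level is a quasi-isometry.

  It remains to prove the bottleneck property of \<open>CK\<close>. A path from \<open>a\<close> to \<open>b\<close> projects to a coarse
  path in each space \<open>Y\<close>, which has to pass close to a bottleneck path in \<open>Y\<close>. The projection to \<open>Y\<close>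
  only changes along edges that are close to \<open>Y\<close>, so the path comes close to the bottleneck path
  whenever \<open>a\<close> and \<open>b\<close> have different projections. The bottleneck paths in the spaces \<open>Y\<close> where the
  projections are far apart, connected by edges of length \<open>K\<close>, form a path from \<open>a\<close> to \<open>b\<close>.\<close>

section \<open>Walks and connectivity\<close>

lemma walk_in_verts:
  assumes "wf_graph G" "walk G u w v"
  shows "u \<in> verts G \<and> v \<in> verts G"
  using assms(2)
proof (induction w arbitrary: u)
  case (Cons e w)
  then have "ends G e \<in> verts G \<times> verts G"
    using assms(1) by (auto simp: wf_graph_def)
  with Cons show ?case by auto
qed simp

lemma walk_append:
  "walk G u w v \<Longrightarrow> walk G v w' x \<Longrightarrow> walk G u (w @ w') x"
  by (induction w arbitrary: u) auto

lemma walk_rev: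
  assumes "wf_graph G" "walk G u w v"
  shows "walk G v (rev w) u"
  using assms(2)
proof (induction w arbitrary: u)
  case (Cons e w)
  then obtain u' where e: "e \<in> edges G" "ends G e = (u, u') \<or> ends G e = (u', u)"
    and w: "walk G u' w v" by auto
  have "u \<in> verts G"
    using walk_in_verts[OF assms(1) Cons.prems] by simp
  with e have "walk G u' [e] u" by auto
  with Cons.IH[OF w] show ?case by (simp add: walk_append)
qed simp

definition near :: "('v, 'e) graph \<Rightarrow> ('e \<Rightarrow> nat) \<Rightarrow> nat \<Rightarrow> 'v \<Rightarrow> 'v \<Rightarrow> bool" where
  "near G l n u v \<longleftrightarrow> (\<exists>w. walk G u w v \<and> sum_list (map l w) \<le> n)"

lemma near_refl: "u \<in> verts G \<Longrightarrow> near G l n u u"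
  unfolding near_def by (rule exI[of _ "[]"]) simp

lemma near_mono: "near G l m u v \<Longrightarrow> m \<le> n \<Longrightarrow> near G l n u v"
  unfolding near_def using le_trans by blast

lemma near_trans:
  assumes "near G l m u v" "near G l n v x"
  shows "near G l (m + n) u x"
proof -
  obtain w w' where "walk G u w v" "sum_list (map l w) \<le> m" "walk G v w' x" "sum_list (map l w') \<le> n"
    using assms unfolding near_def by blast
  then have "walk G u (w @ w') x \<and> sum_list (map l (w @ w')) \<le> m + n"
    by (simp add: walk_append)
  then show ?thesis unfolding near_def by blast
qed

lemma near_sym:
  assumes "wf_graph G" "near G l n u v"
  shows "near G l n v u"
proof -
  obtain w where "walk G u w v" "sum_list (map l w) \<le> n"
    using assms(2) unfolding near_def by blast
  then have "walk G v (rev w) u \<and> sum_list (map l (rev w)) \<le> n"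
    by (metis assms(1) walk_rev rev_map sum_list_rev)
  then show ?thesis unfolding near_def by blast
qed

definition adj :: "('v, 'e) graph \<Rightarrow> 'v \<Rightarrow> 'v \<Rightarrow> bool" where
  "adj G u v \<longleftrightarrow> (\<exists>e\<in>edges G. ends G e = (u, v) \<or> ends G e = (v, u))"

lemma adj_sym: "adj G u v \<Longrightarrow> adj G v u"
  unfolding adj_def by blast

lemma adj_in_verts: "wf_graph G \<Longrightarrow> adj G u v \<Longrightarrow> u \<in> verts G \<and> v \<in> verts G"
  unfolding adj_def wf_graph_def by fastforce

lemma near_edge:
  "wf_graph G \<Longrightarrow> e \<in> edges G \<Longrightarrow> ends G e = (u, v) \<or> ends G e = (v, u) \<Longrightarrow> near G l (l e) u v"
  unfolding near_def wf_graph_def by (rule exI[of _ "[e]"]) fastforce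

inductive joined :: "('v, 'e) graph \<Rightarrow> 'v set \<Rightarrow> 'v \<Rightarrow> 'v \<Rightarrow> bool" for G A u where
  joined_refl: "u \<in> A \<Longrightarrow> joined G A u u"
| joined_step: "joined G A u v \<Longrightarrow> adj G v w \<Longrightarrow> w \<in> A \<Longrightarrow> joined G A u w"

lemma joined_in: "joined G A u v \<Longrightarrow> u \<in> A \<and> v \<in> A"
  by (induction rule: joined.induct) auto

lemma joined_trans: "joined G A v w \<Longrightarrow> joined G A u v \<Longrightarrow> joined G A u w"
  by (induction rule: joined.induct) (auto intro: joined_step)

lemma joined_edge: "u \<in> A \<Longrightarrow> v \<in> A \<Longrightarrow> adj G u v \<Longrightarrow> joined G A u v"
  by (auto intro: joined.intros)

lemma joined_sym: "joined G A u v \<Longrightarrow> joined G A v u"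
proof (induction rule: joined.induct)
  case (joined_step v w)
  then have "joined G A w v"
    using joined_in by (metis adj_sym joined_edge)
  with joined_step.IH show ?case by (rule joined_trans)
qed (rule joined.joined_refl)

lemma joined_mono: "joined G A u v \<Longrightarrow> A \<subseteq> B \<Longrightarrow> joined G B u v"
  by (induction rule: joined.induct) (auto intro: joined.intros)

lemma joined_in_verts: "joined G A u v \<Longrightarrow> wf_graph G \<Longrightarrow> u \<in> verts G \<Longrightarrow> v \<in> verts G"
  by (induction rule: joined.induct) (auto dest: adj_in_verts)

lemma joined_leaves:
  "joined G A u v \<Longrightarrow> P u \<Longrightarrow> \<not> P v \<Longrightarrow> \<exists>a\<in>A. \<exists>b. adj G a b \<and> P a \<and> \<not> P b"
  by (induction rule: joined.induct) (auto dest: joined_in)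

lemma joined_imp_walk:
  assumes "joined G A u v" "u \<in> verts G" "wf_graph G"
  shows "\<exists>w. walk G u w v \<and> (\<forall>e\<in>set w. fst (ends G e) \<in> A \<and> snd (ends G e) \<in> A)"
  using assms(1)
proof (induction rule: joined.induct)
  case joined_refl
  show ?case by (rule exI[of _ "[]"]) (simp add: assms(2))
next
  case (joined_step v x)
  then obtain w where w: "walk G u w v" "\<forall>e\<in>set w. fst (ends G e) \<in> A \<and> snd (ends G e) \<in> A"
    by blast
  obtain e where e: "e \<in> edges G" "ends G e = (v, x) \<or> ends G e = (x, v)"
    using joined_step unfolding adj_def by blast
  have "x \<in> verts G"
    using adj_in_verts[OF assms(3)] joined_step by blast
  then have "walk G v [e] x" using e by auto
  then have "walk G u (w @ [e]) x" by (rule walk_append[OF w(1)])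
  moreover have "fst (ends G e) \<in> A \<and> snd (ends G e) \<in> A"
    using e joined_step joined_in[OF joined_step.hyps(1)] by auto
  ultimately show ?case using w(2) by (intro exI[of _ "w @ [e]"]) auto
qed

lemma walk_imp_joined:
  "walk G u w v \<Longrightarrow> joined G {x. Vert x \<in> walk_points G u w} u v"
proof (induction w arbitrary: u)
  case Nil
  then show ?case by (auto simp: walk_points_def intro: joined_refl)
next
  case (Cons e w)
  then obtain u' where e: "e \<in> edges G" "ends G e = (u, u') \<or> ends G e = (u', u)"
    and w: "walk G u' w v" by auto
  let ?A = "{x. Vert x \<in> walk_points G u (e # w)}"
  have "joined G ?A u' v"
    by (rule joined_mono[OF Cons.IH[OF w]]) (use e in \<open>auto simp: walk_points_def\<close>)
  moreover have "joined G ?A u u'"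
    by (rule joined_edge) (use e in \<open>auto simp: walk_points_def adj_def\<close>)
  ultimately show ?case by (rule joined_trans)
qed

text \<open>Paths enter only through the sets of vertices they meet: \<open>S\<close> contains the path of the
  bottleneck property, \<open>A\<close> is the vertex set of an arbitrary competitor.\<close>

definition coarse_bottleneck :: "nat \<Rightarrow> ('v, 'e) graph \<Rightarrow> ('e \<Rightarrow> nat) \<Rightarrow> bool" where
  "coarse_bottleneck D G l \<longleftrightarrow> (\<forall>u\<in>verts G. \<forall>v\<in>verts G. \<exists>S. joined G S u v \<and>
     (\<forall>x\<in>S. \<forall>A. joined G A u v \<longrightarrow> (\<exists>y\<in>A. near G l D x y)))"

section \<open>The metric realization of a graph with integral edge lengths\<close>

locale weighted_graph =
  fixes H :: "('v, 'e) graph" and l :: "'e \<Rightarrow> nat" and K :: nat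
  assumes conn: "connected_graph H"
    and length_bounds: "e \<in> edges H \<Longrightarrow> 1 \<le> l e \<and> l e \<le> K"
begin

abbreviation len :: "'e \<Rightarrow> real" where
  "len \<equiv> (\<lambda>e. real (l e))"

definition nd :: "'v \<Rightarrow> 'v \<Rightarrow> nat" where
  "nd u v = (LEAST n. near H l n u v)"

lemma wf: "wf_graph H"
  using conn by (simp add: connected_graph_def)

lemma near_iff:
  assumes "u \<in> verts H" "v \<in> verts H"
  shows "near H l n u v \<longleftrightarrow> nd u v \<le> n"
proof -
  obtain w where "walk H u w v"
    using conn assms unfolding connected_graph_def by blast
  then have "near H l (sum_list (map l w)) u v"
    unfolding near_def by blast
  then have "near H l (nd u v) u v"
    unfolding nd_def by (rule LeastI)
  then show ?thesis
    unfolding nd_def by (metis Least_le near_mono)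
qed

lemma nd_attained:
  assumes "u \<in> verts H" "v \<in> verts H"
  obtains w where "walk H u w v" "sum_list (map l w) = nd u v"
proof -
  have "near H l (nd u v) u v"
    using near_iff assms by blast
  then obtain w where w: "walk H u w v" "sum_list (map l w) \<le> nd u v"
    unfolding near_def by blast
  then have "near H l (sum_list (map l w)) u v"
    unfolding near_def by blast
  then have "nd u v \<le> sum_list (map l w)"
    using near_iff assms by blast
  with w that show ?thesis by force
qed

lemma nd_refl [simp]: "u \<in> verts H \<Longrightarrow> nd u u = 0"
  using near_iff[of u u 0] near_refl[of u H l 0] by simp

lemma nd_triangle:
  "u \<in> verts H \<Longrightarrow> v \<in> verts H \<Longrightarrow> w \<in> verts H \<Longrightarrow> nd u w \<le> nd u v + nd v w"
  using near_trans[of H l "nd u v" u v "nd v w" w] near_iff by blast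

lemma nd_sym: "nd u v = nd v u"
proof -
  have "near H l n u v = near H l n v u" for n
    using near_sym[OF wf] by blast
  then show ?thesis by (simp add: nd_def)
qed

lemma nd_edge:
  "e \<in> edges H \<Longrightarrow> ends H e = (u, v) \<or> ends H e = (v, u) \<Longrightarrow> nd u v \<le> l e"
  using near_edge[OF wf] Least_le[of "\<lambda>n. near H l n u v"] unfolding nd_def by blast

lemma nd_first_step:
  assumes "u \<in> verts H" "v \<in> verts H" "u \<noteq> v"
  obtains e x where "e \<in> edges H" "ends H e = (u, x) \<or> ends H e = (x, u)" "x \<in> verts H"
    "nd u v = l e + nd x v" "nd u x = l e"
proof -
  obtain w where w: "walk H u w v" "sum_list (map l w) = nd u v"
    using nd_attained assms by blast
  with assms(3) obtain e w' where ew: "w = e # w'" by (cases w) auto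
  with w obtain x where x: "e \<in> edges H" "ends H e = (u, x) \<or> ends H e = (x, u)" "walk H x w' v"
    by auto
  have xv: "x \<in> verts H"
    using walk_in_verts[OF wf x(3)] by simp
  have "near H l (sum_list (map l w')) x v"
    unfolding near_def using x(3) by blast
  then have "nd x v \<le> sum_list (map l w')"
    using near_iff assms(2) xv by blast
  moreover have "nd u x \<le> l e" by (rule nd_edge[OF x(1,2)])
  moreover have "nd u v \<le> nd u x + nd x v"
    using nd_triangle assms xv by blast
  ultimately have "nd u v = l e + nd x v" "nd u x = l e"
    using w(2) ew by auto
  with x xv that show ?thesis by blast
qed

lemma nd_eq_0:
  assumes "u \<in> verts H" "v \<in> verts H" "nd u v = 0"
  shows "u = v"
proof (rule ccontr)
  assume "u \<noteq> v"
  with assms obtain e x where "e \<in> edges H" "nd u v = l e + nd x v"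
    using nd_first_step by metis
  with length_bounds[of e] assms(3) show False by simp
qed

lemma joined_geodesic:
  assumes "u \<in> verts H" "v \<in> verts H" "\<And>x. x \<in> verts H \<Longrightarrow> nd u x + nd x v = nd u v \<Longrightarrow> x \<in> A"
  shows "joined H A u v"
  using assms(1,3)
proof (induction "nd u v" arbitrary: u rule: less_induct)
  case less
  show ?case
  proof (cases "u = v")
    case True
    have "nd u u + nd u v = nd u v" using less(2) by simp
    with True less(2,3) show ?thesis by (metis joined_refl)
  next
    case False
    with less(2) assms(2) obtain e x where e: "e \<in> edges H" "ends H e = (u, x) \<or> ends H e = (x, u)"
      "x \<in> verts H" "nd u v = l e + nd x v" "nd u x = l e"
      by (metis nd_first_step)
    have "u \<in> A" using less(2,3) nd_refl by simp
    moreover have "x \<in> A" using less(3) e by simp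
    moreover have "adj H u x" using e unfolding adj_def by blast
    ultimately have "joined H A u x" by (rule joined_edge)
    moreover have "joined H A x v"
    proof (rule less(1))
      show "nd x v < nd u v" using e length_bounds[of e] by simp
      fix y assume y: "y \<in> verts H" "nd x y + nd y v = nd x v"
      have "nd u y \<le> nd u x + nd x y" "nd u v \<le> nd u y + nd y v"
        using nd_triangle y(1) e(3) less(2) assms(2) by auto
      with y e have "nd u y + nd y v = nd u v" by linarith
      with less(3) y(1) show "y \<in> A" by blast
    qed (fact e)
    ultimately show ?thesis using joined_trans by metis
  qed
qed

lemma vert_dist_eq:
  assumes "u \<in> verts H" "v \<in> verts H"
  shows "vert_dist H len u v = ennreal (real (nd u v))"
proof -
  have sum: "sum_list (map len w) = real (sum_list (map l w))" for w
    by (induction w) auto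
  show ?thesis
    unfolding vert_dist_def
  proof (rule antisym)
    obtain w where w: "walk H u w v" "sum_list (map l w) = nd u v"
      using nd_attained assms by blast
    then show "(INF w\<in>{w. walk H u w v}. ennreal (sum_list (map len w))) \<le> ennreal (real (nd u v))"
      by (intro INF_lower2[of w]) (auto simp: sum)
    show "ennreal (real (nd u v)) \<le> (INF w\<in>{w. walk H u w v}. ennreal (sum_list (map len w)))"
    proof (rule INF_greatest)
      fix w assume "w \<in> {w. walk H u w v}"
      then have "near H l (sum_list (map l w)) u v"
        unfolding near_def by blast
      then have "nd u v \<le> sum_list (map l w)"
        using near_iff assms by blast
      then show "ennreal (real (nd u v)) \<le> ennreal (sum_list (map len w))"
        by (simp add: sum ennreal_leI)
    qed
  qed
qed

definition route :: "('v, 'e) pt \<Rightarrow> ('v, 'e) pt \<Rightarrow> real \<Rightarrow> bool" where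
  "route x y c \<longleftrightarrow> (\<exists>e s t. x = Inner e s \<and> y = Inner e t \<and> c = \<bar>s - t\<bar>) \<or>
     (\<exists>u r v s. (u, r) \<in> exits H len x \<and> (v, s) \<in> exits H len y \<and> c = r + real (nd u v) + s)"

lemma ends_in_verts: "e \<in> edges H \<Longrightarrow> fst (ends H e) \<in> verts H \<and> snd (ends H e) \<in> verts H"
  using wf unfolding wf_graph_def by fastforce

lemma exits_point:
  assumes "x \<in> points H len" "(u, r) \<in> exits H len x"
  shows "u \<in> verts H \<and> 0 \<le> r"
  using assms ends_in_verts unfolding points_def by auto

lemma exits_finite: "finite (exits H len x)" "exits H len x \<noteq> {}"
  by (cases x; simp)+

lemma INF_attained:
  assumes "finite A" "A \<noteq> {}"
  shows "\<exists>a\<in>A. (INF a\<in>A. f a) = (f a :: ennreal)"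
proof -
  have "Min (f ` A) \<in> f ` A" using assms by (intro Min_in) auto
  moreover have "(INF a\<in>A. f a) = Min (f ` A)"
    using assms by (intro cInf_eq_Min) auto
  ultimately show ?thesis by auto
qed

lemma path_edist_routes:
  assumes "x \<in> points H len" "y \<in> points H len"
  shows "\<exists>c\<ge>0. route x y c \<and> path_edist H len x y = ennreal c"
    and "route x y c \<Longrightarrow> path_edist H len x y \<le> ennreal c"
proof -
  let ?f = "\<lambda>p q. ennreal (snd p) + vert_dist H len (fst p) (fst q) + ennreal (snd q)"
  let ?I = "INF p\<in>exits H len x. INF q\<in>exits H len y. ?f p q"
  have ed: "path_edist H len x y = min (within_edge_dist x y) ?I"
    unfolding path_edist_def by (simp add: case_prod_beta)
  have f: "?f p q = ennreal (snd p + real (nd (fst p) (fst q)) + snd q) \<and>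
      0 \<le> snd p + real (nd (fst p) (fst q)) + snd q"
    if "p \<in> exits H len x" "q \<in> exits H len y" for p q
  proof -
    have "fst p \<in> verts H" "0 \<le> snd p" "fst q \<in> verts H" "0 \<le> snd q"
      using exits_point[OF assms(1), of "fst p" "snd p"] exits_point[OF assms(2), of "fst q" "snd q"] that
      by auto
    then show ?thesis by (simp add: vert_dist_eq ennreal_plus)
  qed
  have "\<exists>p\<in>exits H len x. ?I = (INF q\<in>exits H len y. ?f p q)"
    by (rule INF_attained) (rule exits_finite)+
  then obtain p where p: "p \<in> exits H len x" "?I = (INF q\<in>exits H len y. ?f p q)" by blast
  have "\<exists>q\<in>exits H len y. (INF q\<in>exits H len y. ?f p q) = ?f p q"
    by (rule INF_attained) (rule exits_finite)+
  then obtain q where q: "q \<in> exits H len y" "?I = ?f p q" using p by metis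
  define c where "c = snd p + real (nd (fst p) (fst q)) + snd q"
  have c: "?I = ennreal c" "0 \<le> c"
    using f p q by (auto simp: c_def)
  have rc: "route x y c"
    unfolding route_def c_def using p q by (metis prod.collapse)
  show "\<exists>c\<ge>0. route x y c \<and> path_edist H len x y = ennreal c"
  proof (cases "within_edge_dist x y \<le> ennreal c")
    case True
    then obtain e s t where est: "x = Inner e s" "y = Inner e t"
      by (cases x; cases y) (auto split: if_splits simp: top_unique)
    then have "path_edist H len x y = ennreal \<bar>s - t\<bar>"
      using min_absorb1[OF True] ed c(1) by simp
    moreover have "route x y \<bar>s - t\<bar>" using est unfolding route_def by blast
    ultimately show ?thesis by (metis abs_ge_zero)
  next
    case False
    then have "path_edist H len x y = ennreal c"
      using ed c(1) min_absorb2[of "ennreal c" "within_edge_dist x y"] by simp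
    with rc c show ?thesis by blast
  qed
  show "path_edist H len x y \<le> ennreal c" if "route x y c" for c
    using that unfolding route_def
  proof (elim disjE exE conjE)
    fix e s t assume "x = Inner e s" "y = Inner e t" "c = \<bar>s - t\<bar>"
    then have "within_edge_dist x y = ennreal c" by simp
    then show ?thesis unfolding ed by (intro min.coboundedI1) simp
  next
    fix u r v s
    assume *: "(u, r) \<in> exits H len x" "(v, s) \<in> exits H len y" "c = r + real (nd u v) + s"
    have "?I \<le> ?f (u, r) (v, s)"
      by (rule INF_lower2[OF *(1)], rule INF_lower[OF *(2)])
    also have "\<dots> = ennreal c" using f[OF *(1,2)] *(3) by simp
    finally show ?thesis unfolding ed by (rule min.coboundedI2)
  qed
qed

abbreviation pd :: "('v, 'e) pt \<Rightarrow> ('v, 'e) pt \<Rightarrow> real" where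
  "pd \<equiv> path_dist H len"

lemma path_dist_nonneg: "0 \<le> pd x y"
  by (simp add: path_dist_def)

lemma path_dist_le:
  assumes "x \<in> points H len" "y \<in> points H len" "route x y c"
  shows "pd x y \<le> c"
proof -
  obtain b where b: "b \<ge> 0" "path_edist H len x y = ennreal b"
    using path_edist_routes(1)[OF assms(1,2)] by blast
  have "0 \<le> c"
    using assms(3) exits_point[OF assms(1)] exits_point[OF assms(2)] unfolding route_def by fastforce
  then show ?thesis
    using path_edist_routes(2)[OF assms] b unfolding path_dist_def by simp
qed

lemma path_dist_route:
  assumes "x \<in> points H len" "y \<in> points H len"
  shows "route x y (pd x y)"
  using path_edist_routes(1)[OF assms] unfolding path_dist_def by auto

lemma Vert_point [simp]: "Vert v \<in> points H len \<longleftrightarrow> v \<in> verts H"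
  by (auto simp: points_def)

lemma Inner_point [simp]: "Inner e t \<in> points H len \<longleftrightarrow> e \<in> edges H \<and> 0 < t \<and> t < len e"
  by (auto simp: points_def)

lemma path_dist_Vert: "u \<in> verts H \<Longrightarrow> v \<in> verts H \<Longrightarrow> pd (Vert u) (Vert v) = real (nd u v)"
  using path_dist_route[of "Vert u" "Vert v"] by (auto simp: route_def)

lemma exits_triangle:
  assumes "x \<in> points H len" "(u, r) \<in> exits H len x" "(v, s) \<in> exits H len x"
  shows "real (nd u v) \<le> r + s"
proof (cases x)
  case (Vert a)
  then show ?thesis using assms by simp
next
  case (Inner e t)
  have e: "e \<in> edges H" "0 < t" "t < len e" using assms(1) Inner by auto
  have "nd (fst (ends H e)) (snd (ends H e)) \<le> l e" "nd (snd (ends H e)) (fst (ends H e)) \<le> l e"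
    by (rule nd_edge; simp add: e)+
  then show ?thesis using assms(2,3) Inner e ends_in_verts[OF e(1)] by auto
qed

lemma exits_along_edge:
  assumes "(u, r) \<in> exits H len (Inner e s)"
  shows "\<exists>r'\<le>r + \<bar>s - t\<bar>. (u, r') \<in> exits H len (Inner e t)"
proof -
  have "(u, r) = (fst (ends H e), s) \<or> (u, r) = (snd (ends H e), len e - s)"
    using assms by simp
  then show ?thesis
  proof
    assume "(u, r) = (fst (ends H e), s)"
    then show ?thesis by (intro exI[of _ t]) auto
  next
    assume "(u, r) = (snd (ends H e), len e - s)"
    then show ?thesis by (intro exI[of _ "len e - t"]) auto
  qed
qed

lemma path_dist_sym: "pd x y = pd y x"
proof -
  have v: "vert_dist H len u v = vert_dist H len v u" for u v
  proof -
    have "vert_dist H len u v \<le> vert_dist H len v u" for u v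
      unfolding vert_dist_def
    proof (rule INF_greatest)
      fix w assume "w \<in> {w. walk H v w u}"
      then have "walk H u (rev w) v" by (simp add: walk_rev[OF wf])
      moreover have "sum_list (map len (rev w)) = sum_list (map len w)"
        by (metis rev_map sum_list_rev)
      ultimately show "(INF w\<in>{w. walk H u w v}. ennreal (sum_list (map len w))) \<le> ennreal (sum_list (map len w))"
        by (intro INF_lower2[of "rev w"]) auto
    qed
    then show ?thesis by (simp add: antisym)
  qed
  have "within_edge_dist x y = within_edge_dist y x"
    by (cases x; cases y) (auto simp: abs_minus_commute)
  moreover have "(INF (u, r)\<in>exits H len x. INF (v, s)\<in>exits H len y. ennreal r + vert_dist H len u v + ennreal s) =
      (INF (v, s)\<in>exits H len y. INF (u, r)\<in>exits H len x. ennreal s + vert_dist H len v u + ennreal r)"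
    unfolding case_prod_beta
  proof (subst INF_commute, intro INF_cong refl)
    fix p q :: "'v \<times> real"
    show "ennreal (snd p) + vert_dist H len (fst p) (fst q) + ennreal (snd q) =
        ennreal (snd q) + vert_dist H len (fst q) (fst p) + ennreal (snd p)"
      using v[of "fst p" "fst q"] by (simp only: ac_simps)
  qed
  ultimately show ?thesis unfolding path_dist_def path_edist_def by simp
qed

lemma path_dist_triangle:
  assumes "x \<in> points H len" "y \<in> points H len" "z \<in> points H len"
  shows "pd x z \<le> pd x y + pd y z"
proof -
  have within: "pd x z \<le> \<bar>s - t\<bar> + pd y z"
    if xyz: "x \<in> points H len" "y \<in> points H len" "z \<in> points H len" "x = Inner e s" "y = Inner e t"
    for x y z e s t
    using path_dist_route[OF that(2,3)] unfolding route_def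
  proof (elim disjE exE conjE)
    fix e' s' t' assume *: "y = Inner e' s'" "z = Inner e' t'" "pd y z = \<bar>s' - t'\<bar>"
    have "route x z \<bar>s - t'\<bar>" using that * unfolding route_def by blast
    from path_dist_le[OF that(1,3) this] have "pd x z \<le> \<bar>s - t'\<bar>" .
    also have "\<dots> \<le> \<bar>s - t\<bar> + \<bar>t - t'\<bar>" by simp
    also have "\<dots> = \<bar>s - t\<bar> + pd y z" using * that(5) by simp
    finally show ?thesis .
  next
    fix u r v q
    assume *: "(u, r) \<in> exits H len y" "(v, q) \<in> exits H len z" "pd y z = r + real (nd u v) + q"
    obtain r' where r': "r' \<le> r + \<bar>t - s\<bar>" "(u, r') \<in> exits H len x"
      using exits_along_edge[of u r e t s] *(1) xyz(4,5) by auto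
    then have "route x z (r' + real (nd u v) + q)" using * unfolding route_def by blast
    from path_dist_le[OF that(1,3) this] show ?thesis using * r' by linarith
  qed
  show ?thesis
    using path_dist_route[OF assms(1,2)] unfolding route_def
  proof (elim disjE exE conjE)
    fix e s t assume *: "x = Inner e s" "y = Inner e t" "pd x y = \<bar>s - t\<bar>"
    show ?thesis using within[OF assms *(1,2)] * by simp
  next
    fix u r v s
    assume 1: "(u, r) \<in> exits H len x" "(v, s) \<in> exits H len y" "pd x y = r + real (nd u v) + s"
    show ?thesis
      using path_dist_route[OF assms(2,3)] unfolding route_def
    proof (elim disjE exE conjE)
      fix e a b assume *: "y = Inner e a" "z = Inner e b" "pd y z = \<bar>a - b\<bar>"
      have "pd z x \<le> \<bar>b - a\<bar> + pd y x"
        using within[OF assms(3,2,1) *(2,1)] .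
      then show ?thesis using * path_dist_sym by (metis abs_minus_commute add.commute)
    next
      fix v' s' w q
      assume 2: "(v', s') \<in> exits H len y" "(w, q) \<in> exits H len z" "pd y z = s' + real (nd v' w) + q"
      have "route x z (r + real (nd u w) + q)" using 1 2 unfolding route_def by blast
      then have "pd x z \<le> r + real (nd u w) + q" by (rule path_dist_le[OF assms(1,3)])
      moreover have "u \<in> verts H" "v \<in> verts H" "v' \<in> verts H" "w \<in> verts H"
        using exits_point assms 1 2 by blast+
      then have "nd u w \<le> nd u v + nd v v' + nd v' w"
        using nd_triangle[of u v w] nd_triangle[of v v' w] by simp
      then have "real (nd u w) \<le> real (nd u v) + real (nd v v') + real (nd v' w)"
        by linarith
      moreover have "real (nd v v') \<le> s + s'"
        by (rule exits_triangle[OF assms(2) 1(2) 2(1)])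
      ultimately show ?thesis using 1 2 by linarith
    qed
  qed
qed

lemma path_dist_eq_0:
  assumes "x \<in> points H len" "y \<in> points H len"
  shows "pd x y = 0 \<longleftrightarrow> x = y"
proof
  assume "x = y"
  then have "route x y 0"
  proof (cases x)
    case (Vert v)
    with \<open>x = y\<close> assms show ?thesis by (auto simp: route_def)
  next
    case (Inner e t)
    with \<open>x = y\<close> show ?thesis unfolding route_def by (intro disjI1) auto
  qed
  from path_dist_le[OF assms this] path_dist_nonneg[of x y] show "pd x y = 0" by linarith
next
  assume 0: "pd x y = 0"
  have "route x y 0" using path_dist_route[OF assms] 0 by simp
  then show "x = y" unfolding route_def
  proof (elim disjE exE conjE)
    fix u r v s
    assume *: "(u, r) \<in> exits H len x" "(v, s) \<in> exits H len y" "0 = r + real (nd u v) + s"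
    have uv: "u \<in> verts H" "v \<in> verts H" "0 \<le> r" "0 \<le> s"
      using exits_point assms * by blast+
    with * have "r = 0" "s = 0" "nd u v = 0" by auto
    moreover have "w = Vert a" if "w \<in> points H len" "(a, 0) \<in> exits H len w" for w a
      using that by (cases w) auto
    ultimately have "x = Vert u" "y = Vert v" "u = v"
      using * assms nd_eq_0[OF uv(1,2)] by blast+
    then show ?thesis by simp
  qed auto
qed

lemma Metric_points: "Metric_space (points H len) pd"
proof (rule Metric_space.intro)
  fix x y z
  show "0 \<le> pd x y" by (rule path_dist_nonneg)
  show "pd x y = pd y x" by (rule path_dist_sym)
  assume "x \<in> points H len" "y \<in> points H len"
  then show "pd x y = 0 \<longleftrightarrow> x = y" by (rule path_dist_eq_0)
  assume "z \<in> points H len"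
  with \<open>x \<in> _\<close> \<open>y \<in> _\<close> show "pd x z \<le> pd x y + pd y z" by (rule path_dist_triangle)
qed

text \<open>A curve of length \<open>c\<close> parametrized with speed at most one; it is a geodesic as soon as \<open>c\<close>
  is the distance of its end points.\<close>

definition lipcurve :: "('v, 'e) pt \<Rightarrow> ('v, 'e) pt \<Rightarrow> real \<Rightarrow> bool" where
  "lipcurve x y c \<longleftrightarrow> 0 \<le> c \<and> (\<exists>\<gamma>. \<gamma> ` {0..c} \<subseteq> points H len \<and> \<gamma> 0 = x \<and> \<gamma> c = y \<and>
     (\<forall>s t. 0 \<le> s \<longrightarrow> s \<le> t \<longrightarrow> t \<le> c \<longrightarrow> pd (\<gamma> s) (\<gamma> t) \<le> t - s))"

lemma lipcurveI:
  assumes "0 \<le> c" "\<And>t. 0 \<le> t \<Longrightarrow> t \<le> c \<Longrightarrow> \<gamma> t \<in> points H len" "\<gamma> 0 = x" "\<gamma> c = y"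
    "\<And>s t. 0 \<le> s \<Longrightarrow> s \<le> t \<Longrightarrow> t \<le> c \<Longrightarrow> pd (\<gamma> s) (\<gamma> t) \<le> t - s"
  shows "lipcurve x y c"
  unfolding lipcurve_def
proof (intro conjI exI[of _ \<gamma>] allI impI)
  show "\<gamma> ` {0..c} \<subseteq> points H len" using assms(2) by (simp add: image_subset_iff)
qed (fact assms)+

lemma lipcurve_refl:
  assumes "x \<in> points H len"
  shows "lipcurve x x 0"
  by (rule lipcurveI[where \<gamma> = "\<lambda>_. x"]) (use assms path_dist_eq_0[of x x] in simp_all)

lemma lipcurve_trans:
  assumes "lipcurve x y a" "lipcurve y z b"
  shows "lipcurve x z (a + b)"
proof -
  obtain f where f: "0 \<le> a" "f ` {0..a} \<subseteq> points H len" "f 0 = x" "f a = y"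
    "\<And>s t. 0 \<le> s \<Longrightarrow> s \<le> t \<Longrightarrow> t \<le> a \<Longrightarrow> pd (f s) (f t) \<le> t - s"
    using assms(1) unfolding lipcurve_def by blast
  obtain g where g: "0 \<le> b" "g ` {0..b} \<subseteq> points H len" "g 0 = y" "g b = z"
    "\<And>s t. 0 \<le> s \<Longrightarrow> s \<le> t \<Longrightarrow> t \<le> b \<Longrightarrow> pd (g s) (g t) \<le> t - s"
    using assms(2) unfolding lipcurve_def by blast
  define h where "h t = (if t \<le> a then f t else g (t - a))" for t
  have pts: "h t \<in> points H len" if "0 \<le> t" "t \<le> a + b" for t
    using that f(2) g(2) unfolding h_def image_subset_iff by auto
  have "pd (h s) (h t) \<le> t - s" if st: "0 \<le> s" "s \<le> t" "t \<le> a + b" for s t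
  proof -
    consider "t \<le> a" | "a < s" | "s \<le> a" "a < t" using st by linarith
    then show ?thesis
    proof cases
      case 3
      then have "pd (h s) y \<le> a - s" using st f(4) f(5)[of s a] by (simp add: h_def)
      moreover have "pd y (h t) \<le> t - a" using 3 st g(3) g(5)[of 0 "t - a"] by (simp add: h_def)
      moreover have "y \<in> points H len" using pts[of a] f(1,4) g(1) by (simp add: h_def)
      moreover have "h s \<in> points H len" "h t \<in> points H len" using pts st by simp_all
      ultimately show ?thesis
        using path_dist_triangle[of "h s" y "h t"] by linarith
    next
      case 1
      then show ?thesis using st f(5)[of s t] by (simp add: h_def)
    next
      case 2
      then show ?thesis using st g(5)[of "s - a" "t - a"] by (simp add: h_def)
    qed
  qed
  moreover have "h 0 = x" "h (a + b) = z" "0 \<le> a + b" using f(1,3,4) g(1,3,4) by (auto simp: h_def)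
  ultimately show ?thesis using pts lipcurveI[of "a + b" h x z] by blast
qed

lemma lipcurve_sym:
  assumes "lipcurve x y c"
  shows "lipcurve y x c"
proof -
  obtain f where f: "0 \<le> c" "f ` {0..c} \<subseteq> points H len" "f 0 = x" "f c = y"
    "\<And>s t. 0 \<le> s \<Longrightarrow> s \<le> t \<Longrightarrow> t \<le> c \<Longrightarrow> pd (f s) (f t) \<le> t - s"
    using assms unfolding lipcurve_def by blast
  have "pd (f (c - s)) (f (c - t)) \<le> t - s" if "0 \<le> s" "s \<le> t" "t \<le> c" for s t
    using f(5)[of "c - t" "c - s"] that path_dist_sym[of "f (c - s)"] by simp
  moreover have "f (c - t) \<in> points H len" if "0 \<le> t" "t \<le> c" for t
    using f(2) that by (simp add: image_subset_iff)
  ultimately show ?thesis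
    using lipcurveI[of c "\<lambda>t. f (c - t)" y x] f(1,3,4) by simp
qed

definition edge_pt :: "'e \<Rightarrow> real \<Rightarrow> ('v, 'e) pt" where
  "edge_pt e t = (if t \<le> 0 then Vert (fst (ends H e)) else if len e \<le> t then Vert (snd (ends H e)) else Inner e t)"

lemma lipcurve_edge:
  assumes "e \<in> edges H" "0 \<le> a" "a \<le> b" "b \<le> len e"
  shows "lipcurve (edge_pt e a) (edge_pt e b) (b - a)"
proof -
  have v: "fst (ends H e) \<in> verts H" "snd (ends H e) \<in> verts H"
    using ends_in_verts assms(1) by auto
  have pts: "edge_pt e t \<in> points H len" for t
    using v assms(1) by (auto simp: edge_pt_def)
  have "pd (edge_pt e s) (edge_pt e t) \<le> t - s" if st: "0 \<le> s" "s \<le> t" "t \<le> len e" for s t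
  proof -
    have l: "1 \<le> len e" using length_bounds[OF assms(1)] by simp
    have n: "nd (fst (ends H e)) (snd (ends H e)) \<le> l e"
      by (rule nd_edge) (use assms in auto)
    consider "s = t" | "s = 0" "t = len e" | "s = 0" "0 < t" "t < len e"
      | "0 < s" "s < len e" "t = len e" | "0 < s" "s < t" "t < len e"
      using st by linarith
    then show ?thesis
    proof cases
      case 1
      then show ?thesis using path_dist_eq_0[OF pts pts, of t t] by simp
    next
      case 2
      then show ?thesis using n l v by (simp add: edge_pt_def path_dist_Vert)
    next
      case 3
      then have "route (edge_pt e s) (edge_pt e t) (t - s)"
        using l v by (force simp: edge_pt_def route_def)
      then show ?thesis by (rule path_dist_le[OF pts pts])
    next
      case 4
      then have "route (edge_pt e s) (edge_pt e t) (t - s)"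
        using l v by (force simp: edge_pt_def route_def)
      then show ?thesis by (rule path_dist_le[OF pts pts])
    next
      case 5
      then have "route (edge_pt e s) (edge_pt e t) (t - s)"
        using l by (simp add: edge_pt_def route_def)
      then show ?thesis by (rule path_dist_le[OF pts pts])
    qed
  qed
  then have "pd (edge_pt e (s + a)) (edge_pt e (t + a)) \<le> t - s"
    if "0 \<le> s" "s \<le> t" "t \<le> b - a" for s t
    using that assms by (smt (verit))
  then show ?thesis
    using lipcurveI[of "b - a" "\<lambda>t. edge_pt e (t + a)"] pts assms by simp
qed

lemma lipcurve_exit:
  assumes "x \<in> points H len" "(u, r) \<in> exits H len x"
  shows "lipcurve x (Vert u) r"
proof (cases x)
  case (Vert v)
  then show ?thesis using assms lipcurve_refl by auto
next
  case (Inner e t)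
  then have e: "e \<in> edges H" "0 < t" "t < len e" using assms by auto
  then have E: "edge_pt e t = x" "edge_pt e 0 = Vert (fst (ends H e))" "edge_pt e (len e) = Vert (snd (ends H e))"
    using Inner by (auto simp: edge_pt_def)
  have "lipcurve (Vert (fst (ends H e))) x t"
    using lipcurve_edge[of e 0 t] e E by simp
  moreover have "lipcurve x (Vert (snd (ends H e))) (len e - t)"
    using lipcurve_edge[of e t "len e"] e E by simp
  ultimately show ?thesis using assms(2) Inner lipcurve_sym by auto
qed

lemma lipcurve_walk: "walk H u w v \<Longrightarrow> lipcurve (Vert u) (Vert v) (real (sum_list (map l w)))"
proof (induction w arbitrary: u)
  case Nil
  then show ?case using lipcurve_refl[of "Vert u"] by auto
next
  case (Cons e w)
  then obtain u' where e: "e \<in> edges H" "ends H e = (u, u') \<or> ends H e = (u', u)"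
    and w: "walk H u' w v" by auto
  have "lipcurve (edge_pt e 0) (edge_pt e (len e)) (len e)"
    using lipcurve_edge[of e 0 "len e"] e by simp
  then have "lipcurve (Vert u) (Vert u') (len e)"
    using e length_bounds[of e] lipcurve_sym by (auto simp: edge_pt_def)
  from lipcurve_trans[OF this Cons.IH[OF w]] show ?case by simp
qed

lemma lipcurve_dist:
  assumes "x \<in> points H len" "y \<in> points H len"
  shows "lipcurve x y (pd x y)"
  using path_dist_route[OF assms] unfolding route_def
proof (elim disjE exE conjE)
  fix e s t assume *: "x = Inner e s" "y = Inner e t" "pd x y = \<bar>s - t\<bar>"
  then have "edge_pt e s = x" "edge_pt e t = y" using assms by (auto simp: edge_pt_def)
  then show ?thesis
    using lipcurve_edge[of e s t] lipcurve_edge[of e t s] lipcurve_sym * assms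
    by (cases "s \<le> t") auto
next
  fix u r v s
  assume *: "(u, r) \<in> exits H len x" "(v, s) \<in> exits H len y" "pd x y = r + real (nd u v) + s"
  obtain w where "walk H u w v" "sum_list (map l w) = nd u v"
    using nd_attained exits_point assms * by metis
  then have "lipcurve (Vert u) (Vert v) (real (nd u v))" using lipcurve_walk by metis
  then show ?thesis
    using lipcurve_trans lipcurve_exit[OF assms(1) *(1)] lipcurve_sym[OF lipcurve_exit[OF assms(2) *(2)]] *(3)
    by metis
qed

lemma geodesic_points: "geodesic_space (points H len) pd"
  unfolding geodesic_space_def
proof (intro conjI ballI Metric_points)
  fix x y assume xy: "x \<in> points H len" "y \<in> points H len"
  define c where "c = pd x y"
  obtain f where f: "0 \<le> c" "f ` {0..c} \<subseteq> points H len" "f 0 = x" "f c = y"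
    "\<And>s t. 0 \<le> s \<Longrightarrow> s \<le> t \<Longrightarrow> t \<le> c \<Longrightarrow> pd (f s) (f t) \<le> t - s"
    using lipcurve_dist[OF xy] unfolding lipcurve_def c_def by blast
  have le: "pd (f s) (f t) = t - s" if st: "0 \<le> s" "s \<le> t" "t \<le> c" for s t
  proof (rule antisym)
    have "f s \<in> points H len" "f t \<in> points H len" using f(2) st by auto
    then have "c \<le> pd x (f s) + pd (f s) (f t) + pd (f t) y"
      using path_dist_triangle[of x "f s" y] path_dist_triangle[of "f s" "f t" y] xy unfolding c_def
      by fastforce
    moreover have "pd x (f s) \<le> s" "pd (f t) y \<le> c - t"
      using f(5)[of 0 s] f(5)[of t c] f(3,4) st by auto
    ultimately show "t - s \<le> pd (f s) (f t)" by linarith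
  qed (use f st in blast)
  have "pd (f s) (f t) = \<bar>s - t\<bar>" if "s \<in> {0..c}" "t \<in> {0..c}" for s t
    using le[of s t] le[of t s] that path_dist_sym[of "f s" "f t"] by (cases "s \<le> t") auto
  with f show "\<exists>\<gamma>. \<gamma> ` {0..pd x y} \<subseteq> points H len \<and> \<gamma> 0 = x \<and> \<gamma> (pd x y) = y \<and>
      (\<forall>s\<in>{0..pd x y}. \<forall>t\<in>{0..pd x y}. pd (\<gamma> s) (\<gamma> t) = \<bar>s - t\<bar>)"
    unfolding c_def by blast
qed

end

context weighted_graph
begin

definition base :: "('v, 'e) pt \<Rightarrow> 'v" where
  "base x = (case x of Vert v \<Rightarrow> v | Inner e t \<Rightarrow> fst (ends H e))"

lemma base_Vert [simp]: "base (Vert v) = v"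
  by (simp add: base_def)

lemma base_in_verts: "x \<in> points H len \<Longrightarrow> base x \<in> verts H"
  using ends_in_verts by (cases x) (auto simp: base_def)

lemma base_dist:
  assumes "x \<in> points H len"
  shows "pd x (Vert (base x)) \<le> real K"
proof (cases x)
  case (Vert v)
  then show ?thesis using assms path_dist_Vert[of v v] by simp
next
  case (Inner e t)
  then have e: "e \<in> edges H" "0 < t" "t < len e" using assms by auto
  have v: "fst (ends H e) \<in> verts H" using ends_in_verts[OF e(1)] by simp
  have "(fst (ends H e), t) \<in> exits H len x" "(fst (ends H e), 0) \<in> exits H len (Vert (base x))"
    "t = t + real (nd (fst (ends H e)) (fst (ends H e))) + 0"
    using Inner v by (auto simp: base_def)
  then have "route x (Vert (base x)) t" unfolding route_def by blast
  then have "pd x (Vert (base x)) \<le> t"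
    using path_dist_le[OF assms] base_in_verts[OF assms] by simp
  with e length_bounds[OF e(1)] show ?thesis by linarith
qed

lemma path_dist_base:
  assumes "x \<in> points H len" "y \<in> points H len"
  shows "\<bar>pd x y - real (nd (base x) (base y))\<bar> \<le> 2 * real K"
proof -
  let ?x = "Vert (base x) :: ('v, 'e) pt" and ?y = "Vert (base y) :: ('v, 'e) pt"
  have b: "base x \<in> verts H" "base y \<in> verts H" using base_in_verts assms by auto
  then have p: "?x \<in> points H len" "?y \<in> points H len" by auto
  have "pd x y \<le> pd x ?x + (pd ?x ?y + pd ?y y)"
    using path_dist_triangle[OF assms(1) p(1) assms(2)] path_dist_triangle[OF p assms(2)] by linarith
  moreover have "pd ?x ?y \<le> pd ?x x + (pd x y + pd y ?y)"
    using path_dist_triangle[OF p(1) assms(1) p(2)] path_dist_triangle[OF assms p(2)] by linarith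
  moreover have "pd ?x ?y = real (nd (base x) (base y))" by (rule path_dist_Vert[OF b])
  moreover have "pd ?x x = pd x ?x" "pd y ?y = pd ?y y" by (rule path_dist_sym)+
  ultimately show ?thesis using base_dist[OF assms(1)] base_dist[OF assms(2)] by linarith
qed

end

section \<open>Graphs with the bottleneck property are quasi-trees\<close>

locale bottleneck_graph = weighted_graph H l K
  for H :: "('v, 'e) graph" and l :: "'e \<Rightarrow> nat" and K :: nat +
  fixes D :: nat and root :: 'v
  assumes bottleneck: "coarse_bottleneck D H l"
    and root: "root \<in> verts H"
begin

definition lev :: "'v \<Rightarrow> nat" where
  "lev v = nd root v"

definition upper :: "nat \<Rightarrow> 'v set" where
  "upper n = {v \<in> verts H. n \<le> lev v}"

definition node :: "nat \<Rightarrow> 'v \<Rightarrow> nat \<times> ('v, 'e) pt set" where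
  "node n v = (n, Vert ` {u. joined H (upper n) v u})"

lemma upper_mono: "m \<le> n \<Longrightarrow> upper n \<subseteq> upper m"
  unfolding upper_def by auto

lemma node_eq_iff:
  assumes "v \<in> upper n"
  shows "node n u = node m v \<longleftrightarrow> n = m \<and> joined H (upper n) u v"
proof
  assume eq: "node n u = node m v"
  then have "n = m" by (simp add: node_def)
  moreover have "Vert ` {w. joined H (upper n) u w} = (Vert ` {w. joined H (upper n) v w} :: ('v, 'e) pt set)"
    using eq \<open>n = m\<close> by (simp add: node_def)
  then have "{w. joined H (upper n) u w} = {w. joined H (upper n) v w}"
    by (simp add: inj_image_eq_iff inj_on_def)
  then have "joined H (upper n) u v"
    using joined_refl[OF assms, of H] by blast
  ultimately show "n = m \<and> joined H (upper n) u v" by blast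
next
  assume "n = m \<and> joined H (upper n) u v"
  then have nm: "n = m" and j: "joined H (upper n) u v" by auto
  have "{w. joined H (upper n) u w} = {w. joined H (upper n) v w}"
    using joined_trans[OF _ j] joined_trans[OF _ joined_sym[OF j]] by blast
  with nm show "node n u = node m v" by (simp add: node_def)
qed

lemma node_mono:
  assumes "node n u = node n v" "v \<in> upper n" "m \<le> n"
  shows "node m u = node m v"
proof -
  have "joined H (upper m) u v"
    using assms node_eq_iff joined_mono upper_mono by metis
  then show ?thesis using node_eq_iff joined_in by metis
qed

definition T :: "(nat \<times> ('v, 'e) pt set, (nat \<times> ('v, 'e) pt set) \<times> (nat \<times> ('v, 'e) pt set)) graph" where
  "T = \<lparr>verts = {node n v | n v. v \<in> upper n},
        edges = {(node (Suc n) v, node n v) | n v. v \<in> upper (Suc n)}, ends = id\<rparr>"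

lemma T_simps:
  "verts T = {node n v | n v. v \<in> upper n}"
  "edges T = {(node (Suc n) v, node n v) | n v. v \<in> upper (Suc n)}"
  "ends T e = e"
  by (simp_all add: T_def)

lemma node_in_T: "v \<in> upper n \<Longrightarrow> node n v \<in> verts T"
  by (auto simp: T_simps)

lemma wf_T: "wf_graph T"
  unfolding wf_graph_def using upper_mono[of n "Suc n" for n]
  by (fastforce simp: T_simps)

lemma T_edge_level: "(c, p) \<in> edges T \<Longrightarrow> fst c = Suc (fst p)"
  by (auto simp: T_simps node_def)

lemma T_parent_unique:
  assumes "(c, p) \<in> edges T" "(c, p') \<in> edges T"
  shows "p = p'"
proof -
  obtain n v where v: "c = node (Suc n) v" "p = node n v" "v \<in> upper (Suc n)"
    using assms(1) by (auto simp: T_simps)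
  obtain m u where u: "c = node (Suc m) u" "p' = node m u" "u \<in> upper (Suc m)"
    using assms(2) by (auto simp: T_simps)
  have "n = m" using u v by (simp add: node_def)
  then show ?thesis using node_mono[of "Suc n" v u n] u v by simp
qed

lemma near_ancestor:
  assumes "v \<in> upper (n + k)"
  shows "near T (\<lambda>_. 1) k (node (n + k) v) (node n v)"
  using assms
proof (induction k)
  case 0
  then show ?case by (simp add: near_refl node_in_T)
next
  case (Suc k)
  then have v: "v \<in> upper (Suc (n + k))" by simp
  then have "near T (\<lambda>_. 1) 1 (node (Suc (n + k)) v) (node (n + k) v)"
    by (intro near_edge[OF wf_T]) (auto simp: T_simps)
  moreover have "near T (\<lambda>_. 1) k (node (n + k) v) (node n v)"
    using Suc.IH v upper_mono[of "n + k" "Suc (n + k)"] by auto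
  ultimately show ?case using near_trans by fastforce
qed

lemma joined_upper_0:
  assumes "u \<in> verts H" "v \<in> verts H"
  shows "joined H (upper 0) u v"
  by (rule joined_geodesic[OF assms]) (simp add: upper_def)

lemma connected_T: "connected_graph T"
  unfolding connected_graph_def
proof (intro conjI ballI wf_T)
  have to_root: "\<exists>k. near T (\<lambda>_. 1) k t (node 0 root)" if t: "t \<in> verts T" for t
  proof -
    obtain n v where v: "t = node n v" "v \<in> upper n" using t by (auto simp: T_simps)
    then have "node 0 v = node 0 root"
      using joined_upper_0[of v root] root node_eq_iff[of root 0 v 0] joined_in
      by (metis (no_types, lifting) mem_Collect_eq upper_def)
    then show ?thesis using near_ancestor[of v 0 n] v by auto
  qed
  fix s t assume st: "s \<in> verts T" "t \<in> verts T"
  obtain j k where "near T (\<lambda>_. 1) j s (node 0 root)" "near T (\<lambda>_. 1) k (node 0 root) t"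
    using to_root[OF st(1)] to_root[OF st(2)] near_sym[OF wf_T] by blast
  then have "near T (\<lambda>_. 1) (j + k) s t" by (rule near_trans)
  then show "\<exists>w. walk T s w t" unfolding near_def by blast
qed

text \<open>A trail that descends once has to keep descending, as the only edge towards the root is the
  one it has just used.\<close>

lemma T_trail_descends:
  "walk T t ((c, t) # w) t' \<Longrightarrow> distinct ((c, t) # w) \<Longrightarrow> fst t < fst t'"
proof (induction w arbitrary: c t)
  case Nil
  then have "(c, t) \<in> edges T" "t' = c \<or> c = t" by (auto simp: T_simps(3))
  with T_edge_level[of c t] show ?case by auto
next
  case (Cons e w)
  then have ct: "(c, t) \<in> edges T" by auto
  then have "c \<noteq> t" using T_edge_level[of c t] by auto
  with Cons.prems have w: "walk T c (e # w) t'" by (auto simp: T_simps(3))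
  obtain a b where ab: "e = (a, b)" by (cases e)
  with w have e: "(a, b) \<in> edges T" "c = a \<or> c = b" by (auto simp: T_simps(3))
  have "c \<noteq> a"
    using T_parent_unique[OF ct, of b] e(1) ab Cons.prems(2) by auto
  with e ab have "e = (a, c)" by simp
  with Cons.IH[of c a] w Cons.prems(2) have "fst c < fst t'" by simp
  with T_edge_level[OF ct] show ?case by simp
qed

lemma T_closed_trail_first_edge:
  assumes "walk T t (e # w) t" "distinct (e # w)"
  shows "\<exists>p. e = (t, p) \<and> (t, p) \<in> edges T"
proof -
  obtain a b where ab: "e = (a, b)" by (cases e)
  with assms(1) have e: "(a, b) \<in> edges T" "t = a \<or> t = b" by (auto simp: T_simps(3))
  moreover have "t \<noteq> b"
    using T_trail_descends[of t a w t] assms ab by auto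
  ultimately show ?thesis using ab by auto
qed

lemma tree_T: "tree_graph T"
  unfolding tree_graph_def
proof (intro conjI notI connected_T)
  assume "\<exists>t w. w \<noteq> [] \<and> distinct w \<and> walk T t w t"
  then obtain t w where w: "w \<noteq> []" "distinct w" "walk T t w t" by blast
  then obtain e w' where ew: "w = e # w'" by (cases w) auto
  then obtain p where p: "e = (t, p)" "(t, p) \<in> edges T"
    using T_closed_trail_first_edge w by blast
  have r: "walk T t (rev w) t" "distinct (rev w)" "rev w \<noteq> []"
    using w walk_rev[OF wf_T] by auto
  then obtain e' w'' where ew': "rev w = e' # w''" by (cases "rev w") auto
  then obtain p' where p': "e' = (t, p')" "(t, p') \<in> edges T"
    using T_closed_trail_first_edge r by metis
  have "e' = e" using T_parent_unique p p' by blast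
  then have "w = rev w'' @ [e]" using ew' by (metis rev.simps(2) rev_rev_ident)
  then have "w'' = []"
    using w(2) ew \<open>w = rev w'' @ [e]\<close> by (cases "rev w''") auto
  then have "w = [e]" using ew' \<open>e' = e\<close> by (metis rev_singleton_conv)
  with w(3) p have "t = p" by (auto simp: T_simps(3))
  with T_edge_level[OF p(2)] show False by simp
qed

interpretation T: weighted_graph T "\<lambda>_. 1" 1
  by unfold_locales (auto simp: connected_T)

lemma descend_to_level:
  assumes "v \<in> upper n"
  obtains u where "joined H (upper n) v u" "lev u \<le> n + K" "nd u v + lev u \<le> lev v"
proof -
  have "\<exists>u. joined H (upper n) v u \<and> lev u \<le> n + K \<and> nd u v + lev u \<le> lev v"
    using assms
  proof (induction "lev v" arbitrary: v rule: less_induct)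
    case less
    then have v: "v \<in> verts H" "n \<le> lev v" by (auto simp: upper_def)
    show ?case
    proof (cases "lev v \<le> n + K")
      case True
      then show ?thesis using joined_refl[OF less.prems, of H] v by (intro exI[of _ v]) simp
    next
      case False
      then have "v \<noteq> root" using root by (auto simp: lev_def)
      then obtain e x where e: "e \<in> edges H" "ends H e = (v, x) \<or> ends H e = (x, v)" "x \<in> verts H"
        "nd v root = l e + nd x root" "nd v x = l e"
        using nd_first_step[OF v(1) root] by blast
      then have lx: "lev v = l e + lev x" by (simp add: lev_def nd_sym)
      have le: "1 \<le> l e" "l e \<le> K" using length_bounds[OF e(1)] by auto
      have x: "x \<in> upper n" "lev x < lev v" using lx le False e(3) by (auto simp: upper_def)
      from less.hyps[OF x(2,1)] obtain u where u: "joined H (upper n) x u" "lev u \<le> n + K"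
        "nd u x + lev u \<le> lev x" by blast
      have "joined H (upper n) v x"
        by (rule joined_edge[OF less.prems x(1)]) (use e in \<open>auto simp: adj_def\<close>)
      then have "joined H (upper n) v u" using joined_trans u(1) by metis
      moreover have "u \<in> verts H" using joined_in_verts[OF u(1) wf] e by blast
      then have "nd u v \<le> nd u x + nd x v" using nd_triangle e v by blast
      then have "nd u v + lev u \<le> lev v" using u lx e nd_sym[of x v] by linarith
      ultimately show ?thesis using u(2) by blast
    qed
  qed
  with that show ?thesis by blast
qed

definition B :: nat where
  "B = 2 * (K + 3 * D) + K"

text \<open>Compare the path of the bottleneck property with a path above level \<open>n\<close> and with the
  detour through the root: its vertices lie near level \<open>n\<close> on one of the two geodesics to the root,
  hence near \<open>x\<close> or near \<open>z\<close>. Being connected, it has a vertex near both.\<close>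

lemma joined_upper_bounded:
  assumes j: "joined H (upper n) x z" and x: "lev x \<le> n + K" and z: "lev z \<le> n + K"
  shows "nd x z \<le> B"
proof -
  have v: "x \<in> verts H" "z \<in> verts H"
    using joined_in[OF j] by (auto simp: upper_def)
  obtain S where S: "joined H S x z"
    "\<And>v A. v \<in> S \<Longrightarrow> joined H A x z \<Longrightarrow> \<exists>y\<in>A. near H l D v y"
    using bottleneck v unfolding coarse_bottleneck_def by metis
  let ?A = "{u \<in> verts H. nd root u + nd u x = nd root x} \<union> {u \<in> verts H. nd root u + nd u z = nd root z}"
  have "joined H ?A root x" by (rule joined_geodesic[OF root v(1)]) simp
  then have 1: "joined H ?A x root" by (rule joined_sym)
  have 2: "joined H ?A root z" by (rule joined_geodesic[OF root v(2)]) simp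
  have A: "joined H ?A x z" by (rule joined_trans[OF 2 1])
  define M where "M = K + 3 * D"
  have S_near: "nd x w \<le> M \<or> nd z w \<le> M" if w: "w \<in> S" "w \<in> verts H" for w
  proof -
    obtain y where y: "y \<in> upper n" "near H l D w y" using S(2)[OF w(1) j] by blast
    then have "y \<in> verts H" by (simp add: upper_def)
    then have "nd w y \<le> D" using near_iff w y by blast
    moreover have "nd root y \<le> nd root w + nd w y" using nd_triangle root w \<open>y \<in> verts H\<close> by blast
    ultimately have lw: "n \<le> nd root w + D" using y(1) by (simp add: upper_def lev_def)
    obtain u where u: "u \<in> ?A" "near H l D w u" using S(2)[OF w(1) A] by blast
    have uv: "u \<in> verts H" using u(1) by auto
    then have "nd w u \<le> D" using near_iff w u by blast
    moreover have "nd root w \<le> nd root u + nd u w" using nd_triangle root w uv by blast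
    ultimately have lu: "n \<le> nd root u + 2 * D" "nd u w \<le> D" using lw nd_sym[of u w] by auto
    have close: "nd a w \<le> M" if "a \<in> verts H" "lev a \<le> n + K" "nd root u + nd u a = nd root a" for a
    proof -
      have "nd a w \<le> nd a u + nd u w" using nd_triangle that w uv by blast
      then show ?thesis using that lu nd_sym[of a u] by (simp add: lev_def M_def)
    qed
    from u(1) close[of x] close[of z] v x z show ?thesis by auto
  qed
  have "nd x w \<le> M \<or> nd x z \<le> B" if "joined H S x w" for w
    using that
  proof (induction rule: joined.induct)
    case joined_refl
    then show ?case using v by simp
  next
    case (joined_step w w')
    have wv: "w \<in> verts H" "w' \<in> verts H" using adj_in_verts[OF wf joined_step(2)] by auto
    obtain e where e: "e \<in> edges H" "ends H e = (w, w') \<or> ends H e = (w', w)"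
      using joined_step(2) unfolding adj_def by blast
    then have "nd w w' \<le> K" using nd_edge[OF e] length_bounds[OF e(1)] by simp
    moreover have "nd x z \<le> nd x w + nd w w' + nd w' z"
      using nd_triangle[of x w z] nd_triangle[of w w' z] v wv by fastforce
    ultimately show ?case
      using joined_step.IH S_near[OF joined_step(3) wv(2)] nd_sym[of z w'] by (auto simp: B_def M_def)
  qed
  from this[OF S(1)] show ?thesis by (auto simp: B_def M_def)
qed

definition rep :: "nat \<times> ('v, 'e) pt set \<Rightarrow> 'v" where
  "rep t = (SOME v. v \<in> upper (fst t) \<and> t = node (fst t) v \<and> lev v \<le> fst t + K)"

lemma rep:
  assumes "t \<in> verts T"
  shows "rep t \<in> upper (fst t)" "t = node (fst t) (rep t)" "lev (rep t) \<le> fst t + K"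
proof -
  obtain n v where v: "t = node n v" "v \<in> upper n" using assms by (auto simp: T_simps)
  then have n: "fst t = n" by (simp add: node_def)
  obtain u where u: "joined H (upper n) v u" "lev u \<le> n + K" "nd u v + lev u \<le> lev v"
    using descend_to_level[OF v(2)] .
  then have "u \<in> upper n" using joined_in by metis
  with u v n have "u \<in> upper (fst t) \<and> t = node (fst t) u \<and> lev u \<le> fst t + K"
    using node_eq_iff by simp
  then have "rep t \<in> upper (fst t) \<and> t = node (fst t) (rep t) \<and> lev (rep t) \<le> fst t + K"
    unfolding rep_def by (rule someI)
  then show "rep t \<in> upper (fst t)" "t = node (fst t) (rep t)" "lev (rep t) \<le> fst t + K" by auto
qed

lemma rep_in_verts: "t \<in> verts T \<Longrightarrow> rep t \<in> verts H"
  using rep(1) by (simp add: upper_def)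

lemma node_in_upper:
  assumes "node n u = node n v" "v \<in> upper n"
  shows "joined H (upper n) u v"
  using node_eq_iff assms by blast

lemma rep_edge:
  assumes "(c, p) \<in> edges T"
  shows "nd (rep c) (rep p) \<le> B + K + 1"
proof -
  obtain n v where v: "c = node (Suc n) v" "p = node n v" "v \<in> upper (Suc n)"
    using assms by (auto simp: T_simps)
  have vn: "v \<in> upper n" using v(3) upper_mono[of n "Suc n"] by auto
  have f: "fst c = Suc n" "fst p = n" using v by (auto simp: node_def)
  have c: "c \<in> verts T" and p: "p \<in> verts T" using v vn node_in_T by auto
  note rc = rep[OF c, unfolded f] and rp = rep[OF p, unfolded f]
  have xn: "rep c \<in> upper n" using rc(1) upper_mono[of n "Suc n"] by auto
  obtain u where u: "joined H (upper n) (rep c) u" "lev u \<le> n + K" "nd u (rep c) + lev u \<le> lev (rep c)"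
    using descend_to_level[OF xn] .
  have "node (Suc n) v = node (Suc n) (rep c)" by (rule trans[OF v(1)[symmetric] rc(2)])
  then have "node n (rep c) = node n v" using node_mono[of "Suc n" v "rep c" n] rc(1) by simp
  also have "node n v = node n (rep p)" by (rule trans[OF v(2)[symmetric] rp(2)])
  finally have "node n (rep c) = node n (rep p)" .
  then have "joined H (upper n) (rep c) (rep p)" using node_in_upper rp(1) by blast
  then have "joined H (upper n) u (rep p)" using u(1) joined_trans joined_sym by metis
  then have "nd u (rep p) \<le> B" using joined_upper_bounded u(2) rp(3) by blast
  moreover have uu: "u \<in> upper n" using u(1) joined_in by metis
  then have "u \<in> verts H" by (simp add: upper_def)
  then have "nd (rep c) (rep p) \<le> nd (rep c) u + nd u (rep p)"
    using nd_triangle rep_in_verts c p by blast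
  moreover have "nd u (rep c) \<le> K + 1" using u rc(3) uu by (simp add: upper_def)
  ultimately show ?thesis using nd_sym[of u "rep c"] by linarith
qed

lemma rep_lipschitz:
  assumes "s \<in> verts T" "t \<in> verts T"
  shows "nd (rep s) (rep t) \<le> (B + K + 1) * T.nd s t"
proof -
  have "nd (rep s) (rep t) \<le> (B + K + 1) * length w" if "walk T s w t" for s w
    using that
  proof (induction w arbitrary: s)
    case Nil
    then show ?case using rep_in_verts[of s] by auto
  next
    case (Cons e w)
    then obtain r where e: "e \<in> edges T" "e = (s, r) \<or> e = (r, s)" and w: "walk T r w t"
      by (auto simp: T_simps(3))
    have rt: "r \<in> verts T" "t \<in> verts T" "s \<in> verts T"
      using walk_in_verts[OF wf_T w] walk_in_verts[OF wf_T Cons.prems] by auto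
    have "nd (rep s) (rep r) \<le> B + K + 1" using rep_edge e nd_sym by metis
    moreover have "nd (rep s) (rep t) \<le> nd (rep s) (rep r) + nd (rep r) (rep t)"
      using nd_triangle rep_in_verts rt by blast
    ultimately show ?case using Cons.IH[OF w] by simp
  qed
  moreover obtain w where "walk T s w t" "sum_list (map (\<lambda>_. 1) w) = T.nd s t"
    using T.nd_attained[OF assms] by blast
  moreover from this have "length w = T.nd s t" by (simp add: sum_list_triv)
  ultimately show ?thesis by metis
qed

abbreviation top_node :: "'v \<Rightarrow> nat \<times> ('v, 'e) pt set" where
  "top_node v \<equiv> node (lev v) v"

lemma in_upper_lev: "v \<in> verts H \<Longrightarrow> n \<le> lev v \<Longrightarrow> v \<in> upper n"
  by (simp add: upper_def)

lemma T_nd_ancestor: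
  assumes "v \<in> verts H" "n \<le> lev v"
  shows "T.nd (top_node v) (node n v) \<le> lev v - n"
proof -
  have "near T (\<lambda>_. 1) (lev v - n) (top_node v) (node n v)"
    using near_ancestor[of v n "lev v - n"] assms by (simp add: in_upper_lev)
  then show ?thesis using T.near_iff node_in_T in_upper_lev assms by simp
qed

lemma top_node_edge:
  assumes "e \<in> edges H" "ends H e = (u, v) \<or> ends H e = (v, u)"
  shows "T.nd (top_node u) (top_node v) \<le> l e"
proof -
  have *: "T.nd (top_node v) (top_node u) \<le> l e"
    if "e \<in> edges H" "ends H e = (u, v) \<or> ends H e = (v, u)" "lev u \<le> lev v" for u v
  proof -
    have uv: "u \<in> verts H" "v \<in> verts H" using ends_in_verts[OF that(1)] that(2) by auto
    have "joined H (upper (lev u)) v u"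
      by (rule joined_edge) (use that uv in \<open>auto simp: adj_def upper_def\<close>)
    then have "node (lev u) v = top_node u" using node_eq_iff uv in_upper_lev by simp
    then have "T.nd (top_node v) (top_node u) \<le> lev v - lev u"
      using T_nd_ancestor[OF uv(2) that(3)] by simp
    also have "lev v \<le> lev u + nd u v" unfolding lev_def using nd_triangle root uv by blast
    then have "lev v - lev u \<le> l e" using nd_edge[OF that(1,2)] by linarith
    finally show ?thesis .
  qed
  show ?thesis
  proof (cases "lev u \<le> lev v")
    case True
    then show ?thesis using *[OF assms] T.nd_sym by metis
  next
    case False
    then show ?thesis using *[of v u] assms by auto
  qed
qed

lemma top_node_lipschitz:
  assumes "u \<in> verts H" "v \<in> verts H"
  shows "T.nd (top_node u) (top_node v) \<le> nd u v"
proof -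
  have "T.nd (top_node u) (top_node v) \<le> sum_list (map l w)" if "walk H u w v" for u w
    using that
  proof (induction w arbitrary: u)
    case Nil
    then show ?case using T.nd_refl[OF node_in_T[OF in_upper_lev[of v "lev v"]]] by auto
  next
    case (Cons e w)
    then obtain x where e: "e \<in> edges H" "ends H e = (u, x) \<or> ends H e = (x, u)" and w: "walk H x w v"
      by auto
    have "u \<in> verts H" "x \<in> verts H" "v \<in> verts H"
      using walk_in_verts[OF wf w] walk_in_verts[OF wf Cons.prems] by auto
    then have "T.nd (top_node u) (top_node v) \<le> T.nd (top_node u) (top_node x) + T.nd (top_node x) (top_node v)"
      using T.nd_triangle node_in_T in_upper_lev by simp
    then show ?case using top_node_edge[OF e] Cons.IH[OF w] by simp
  qed
  then show ?thesis using nd_attained[OF assms] by metis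
qed

lemma top_node_expands:
  assumes "u \<in> verts H" "v \<in> verts H"
  shows "nd u v \<le> (B + K + 1) * T.nd (top_node u) (top_node v) + 2 * B"
proof -
  have close: "nd w (rep (top_node w)) \<le> B" if "w \<in> verts H" for w
  proof -
    have t: "top_node w \<in> verts T" using node_in_T in_upper_lev that by simp
    have f: "fst (top_node w) = lev w" by (simp add: node_def)
    note r = rep[OF t, unfolded f]
    have "joined H (upper (lev w)) w (rep (top_node w))" by (rule node_in_upper[OF r(2,1)])
    then show ?thesis using joined_upper_bounded r(3) by simp
  qed
  have t: "top_node u \<in> verts T" "top_node v \<in> verts T" using node_in_T in_upper_lev assms by auto
  let ?u = "rep (top_node u)" and ?v = "rep (top_node v)"
  have r: "?u \<in> verts H" "?v \<in> verts H" using rep_in_verts t by auto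
  have "nd u v \<le> nd u ?u + (nd ?u ?v + nd ?v v)"
    using nd_triangle[OF assms(1) r(1) assms(2)] nd_triangle[OF r assms(2)] by linarith
  then show ?thesis
    using close[OF assms(1)] close[OF assms(2)] rep_lipschitz[OF t] nd_sym[of ?v v] by linarith
qed

lemma top_node_quasi_onto:
  assumes "t \<in> verts T"
  shows "T.nd (top_node (rep t)) t \<le> K"
proof -
  have "T.nd (top_node (rep t)) (node (fst t) (rep t)) \<le> lev (rep t) - fst t"
    by (rule T_nd_ancestor) (use rep(1)[OF assms] in \<open>auto simp: upper_def\<close>)
  also have "node (fst t) (rep t) = t" by (rule rep(2)[OF assms, symmetric])
  finally show ?thesis using rep(3)[OF assms] by simp
qed

lemma quasi_isometry_T:
  "quasi_isometry (points H len) pd (points T unit_len) (path_dist T unit_len)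
     (\<lambda>x. Vert (top_node (base x)))"
proof -
  let ?f = "\<lambda>x. Vert (top_node (base x)) :: (nat \<times> ('v, 'e) pt set, (nat \<times> ('v, 'e) pt set) \<times> (nat \<times> ('v, 'e) pt set)) pt"
  have unit: "unit_len = (\<lambda>_. real 1)" by simp
  define L where "L = real (B + K + 1)"
  define C where "C = real (2 * B + 2 * K + 1)"
  have L: "1 \<le> L" by (simp add: L_def)
  have tb: "top_node (base x) \<in> verts T" if "x \<in> points H len" for x
    using that base_in_verts node_in_T in_upper_lev by simp
  have d: "T.pd (?f x) (?f y) = real (T.nd (top_node (base x)) (top_node (base y)))"
    if "x \<in> points H len" "y \<in> points H len" for x y
    using T.path_dist_Vert tb that by blast
  have bounds: "pd x y / L - C \<le> T.pd (?f x) (?f y) \<and> T.pd (?f x) (?f y) \<le> L * pd x y + C"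
    if xy: "x \<in> points H len" "y \<in> points H len" for x y
  proof
    let ?n = "nd (base x) (base y)" and ?t = "T.nd (top_node (base x)) (top_node (base y))"
    have b: "base x \<in> verts H" "base y \<in> verts H" using base_in_verts xy by auto
    have pn: "\<bar>pd x y - real ?n\<bar> \<le> 2 * real K" by (rule path_dist_base[OF xy])
    have "?t \<le> ?n" by (rule top_node_lipschitz[OF b])
    then have "real ?t \<le> real ?n" by simp
    moreover have "pd x y \<le> L * pd x y" using L path_dist_nonneg[of x y] by (simp add: mult_le_cancel_right1)
    ultimately show "T.pd (?f x) (?f y) \<le> L * pd x y + C" using d[OF xy] pn by (simp add: C_def)
    have "?n \<le> (B + K + 1) * ?t + 2 * B" by (rule top_node_expands[OF b])
    then have "real ?n \<le> L * real ?t + 2 * real B"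
      unfolding L_def by (metis of_nat_add of_nat_le_iff of_nat_mult of_nat_numeral)
    then have "pd x y \<le> L * real ?t + C" using pn by (simp add: C_def)
    also have "\<dots> \<le> L * real ?t + L * C" using L by (simp add: C_def mult_le_cancel_right1)
    finally have "pd x y \<le> L * (real ?t + C)" by (simp add: distrib_left)
    then have "pd x y / L \<le> real ?t + C" using L by (simp add: pos_divide_le_eq mult.commute)
    then show "pd x y / L - C \<le> T.pd (?f x) (?f y)" using d[OF xy] by simp
  qed
  have onto: "\<exists>x\<in>points H len. T.pd (?f x) z \<le> C" if z: "z \<in> points T T.len" for z
  proof
    let ?t = "T.base z"
    have t: "?t \<in> verts T" by (rule T.base_in_verts[OF z])
    show x: "Vert (rep ?t) \<in> points H len" using rep_in_verts[OF t] by simp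
    have r: "top_node (rep ?t) \<in> verts T" using tb[OF x] by simp
    have "T.pd (Vert (top_node (rep ?t))) z \<le>
        T.pd (Vert (top_node (rep ?t))) (Vert ?t) + T.pd (Vert ?t) z"
      using T.path_dist_triangle r t z T.Vert_point by blast
    moreover have "T.pd (Vert (top_node (rep ?t))) (Vert ?t) \<le> real K"
      using top_node_quasi_onto[OF t] T.path_dist_Vert[OF r t] by simp
    moreover have "T.pd (Vert ?t) z \<le> 1"
      using T.base_dist[OF z] T.path_dist_sym[of z] by simp
    ultimately show "T.pd (?f (Vert (rep ?t))) z \<le> C" by (simp add: C_def)
  qed
  have img: "?f ` points H len \<subseteq> points T T.len" using tb T.Vert_point by blast
  have "0 \<le> C" by (simp add: C_def)
  with img L bounds onto show ?thesis unfolding quasi_isometry_def unit by blast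
qed

end

lemma (in weighted_graph) coarse_bottleneck_imp_quasi_tree:
  assumes "coarse_bottleneck D H l"
  shows "quasi_tree (points H len) pd"
proof (cases "verts H = {}")
  case True
  let ?T = "\<lparr>verts = {}, edges = {}, ends = id\<rparr> ::
    (nat \<times> ('v, 'e) pt set, (nat \<times> ('v, 'e) pt set) \<times> (nat \<times> ('v, 'e) pt set)) graph"
  have "edges H = {}" using ends_in_verts True by auto
  with True have e: "points H len = {}" by (simp add: points_def)
  have "walk ?T t w t \<Longrightarrow> w = []" for t w by (cases w) auto
  then have "tree_graph ?T" by (auto simp: tree_graph_def connected_graph_def wf_graph_def)
  moreover have "quasi_isometry (points H len) pd (points ?T unit_len) (path_dist ?T unit_len) f" for f
    unfolding quasi_isometry_def e by (auto simp: points_def intro!: exI[of _ 1])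
  ultimately show ?thesis unfolding quasi_tree_def using geodesic_points by blast
next
  case False
  then obtain r where "r \<in> verts H" by blast
  then interpret bottleneck_graph H l K D r
    using assms by unfold_locales
  show ?thesis
    unfolding quasi_tree_def using geodesic_points tree_T quasi_isometry_T by blast
qed

lemma walk_edges: "walk G u w v \<Longrightarrow> set w \<subseteq> edges G"
  by (induction w arbitrary: u) auto

lemma (in weighted_graph) joined_ball:
  assumes "near H l n u v" "u \<in> verts H" "v \<in> verts H"
    "\<And>x. x \<in> verts H \<Longrightarrow> near H l n x v \<Longrightarrow> x \<in> A"
  shows "joined H A u v"
proof (rule joined_geodesic[OF assms(2,3)])
  fix x assume "x \<in> verts H" "nd u x + nd x v = nd u v"
  moreover have "nd u v \<le> n" using assms near_iff by blast
  ultimately show "x \<in> A" using assms(3,4) near_iff by force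
qed

lemma bottleneck_imp_coarse_bottleneck:
  assumes "connected_graph G" "bottleneck D G" "D \<le> real n"
  shows "coarse_bottleneck n G (\<lambda>_. 1)"
  unfolding coarse_bottleneck_def
proof (intro ballI)
  interpret weighted_graph G "\<lambda>_. 1" 1
    by unfold_locales (auto simp: assms)
  fix u v assume uv: "u \<in> verts G" "v \<in> verts G"
  obtain p where p: "walk G u p v" and pq: "\<And>q x. walk G u q v \<Longrightarrow> x \<in> walk_points G u p \<Longrightarrow>
      \<exists>y\<in>walk_points G u q. path_edist G unit_len x y \<le> ennreal D"
    using assms(2) uv unfolding bottleneck_def by metis
  let ?S = "{x. Vert x \<in> walk_points G u p}"
  have "\<exists>y\<in>A. near G (\<lambda>_. 1) n x y" if x: "x \<in> ?S" and A: "joined G A u v" for x A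
  proof -
    obtain q where q: "walk G u q v" "\<forall>e\<in>set q. fst (ends G e) \<in> A \<and> snd (ends G e) \<in> A"
      using joined_imp_walk[OF A uv(1) wf] by blast
    obtain y where y: "y \<in> walk_points G u q" "path_edist G unit_len (Vert x) y \<le> ennreal D"
      using pq[OF q(1)] x by blast
    have xv: "x \<in> verts G"
      using x walk_edges[OF p] ends_in_verts uv unfolding walk_points_def by auto
    have yp: "y \<in> points G len"
      using y(1) walk_edges[OF q(1)] ends_in_verts uv unfolding walk_points_def points_def by auto
    obtain c where c: "0 \<le> c" "route (Vert x) y c" "path_edist G len (Vert x) y = ennreal c"
      using path_edist_routes(1)[of "Vert x" y] xv yp Vert_point by blast
    have "ennreal c \<le> ennreal D" using y(2) c(3) by simp
    also have "\<dots> \<le> ennreal (real n)" by (rule ennreal_leI[OF assms(3)])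
    finally have cn: "c \<le> real n" by (subst (asm) ennreal_le_iff) simp_all
    obtain w s where w: "(w, s) \<in> exits G len y" "c = real (nd x w) + s"
      using c(2) unfolding route_def by auto
    have wv: "w \<in> verts G" "0 \<le> s" using exits_point[OF yp w(1)] by auto
    have "w \<in> A"
      using w(1) y(1) q(2) joined_in[OF A] by (auto simp: walk_points_def)
    moreover have "real (nd x w) \<le> real n" using w(2) wv(2) cn by linarith
    then have "near G (\<lambda>_. 1) n x w" using near_iff[OF xv wv(1)] by simp
    ultimately show ?thesis by blast
  qed
  with walk_imp_joined[OF p]
  show "\<exists>S. joined G S u v \<and> (\<forall>x\<in>S. \<forall>A. joined G A u v \<longrightarrow> (\<exists>y\<in>A. near G (\<lambda>_. 1) n x y))"
    by blast
qed

section \<open>Projections\<close>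

context graph_projections
begin

abbreviation near1 :: "'i \<Rightarrow> nat \<Rightarrow> 'v \<Rightarrow> 'v \<Rightarrow> bool" where
  "near1 Y \<equiv> near (G Y) (\<lambda>_. 1)"

lemma weighted: "Y \<in> I \<Longrightarrow> weighted_graph (G Y) (\<lambda>_. 1) 1"
  by unfold_locales (auto simp: connected)

lemma wf_G: "Y \<in> I \<Longrightarrow> wf_graph (G Y)"
  using connected by (simp add: connected_graph_def)

lemma proj_in_verts: "X \<in> I \<Longrightarrow> Y \<in> I \<Longrightarrow> X \<noteq> Y \<Longrightarrow> x \<in> proj Y X \<Longrightarrow> x \<in> verts (G Y)"
  using proj_verts by blast

definition close :: "nat \<Rightarrow> 'i \<Rightarrow> 'i \<Rightarrow> 'i \<Rightarrow> bool" where
  "close n Y X Z \<longleftrightarrow> (\<forall>x\<in>proj Y X \<union> proj Y Z. \<forall>z\<in>proj Y X \<union> proj Y Z. near1 Y n x z)"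

lemma close_sym: "close n Y X Z \<longleftrightarrow> close n Y Z X"
  by (simp add: close_def Un_commute)

lemma close_cong: "proj Y X = proj Y X' \<Longrightarrow> proj Y Z = proj Y Z' \<Longrightarrow> close n Y X Z \<longleftrightarrow> close n Y X' Z'"
  by (simp add: close_def)

lemma close_mono: "close m Y X Z \<Longrightarrow> m \<le> n \<Longrightarrow> close n Y X Z"
  unfolding close_def by (intro ballI, rule near_mono) simp_all

lemma proj_dist_le_iff:
  assumes "X \<in> I" "Y \<in> I" "Z \<in> I" "X \<noteq> Y" "Z \<noteq> Y"
  shows "proj_dist G proj Y X Z \<le> of_nat n \<longleftrightarrow> close n Y X Z"
proof -
  interpret weighted_graph "G Y" "\<lambda>_. 1" 1 by (rule weighted[OF assms(2)])
  have "vert_dist (G Y) unit_len x z \<le> of_nat n \<longleftrightarrow> near1 Y n x z"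
    if "x \<in> proj Y X \<union> proj Y Z" "z \<in> proj Y X \<union> proj Y Z" for x z
  proof -
    have "x \<in> verts (G Y)" "z \<in> verts (G Y)" using that proj_in_verts assms by blast+
    then show ?thesis
      using vert_dist_eq[of x z] near_iff[of x z n] by (simp add: ennreal_of_nat_eq_real_of_nat)
  qed
  then show ?thesis unfolding proj_dist_def close_def SUP_le_iff by blast
qed

lemma close_refl: "X \<in> I \<Longrightarrow> Y \<in> I \<Longrightarrow> X \<noteq> Y \<Longrightarrow> close \<theta> Y X X"
  using proj_bounded proj_dist_le_iff by blast

lemma close_trans:
  assumes "X \<in> I" "Y \<in> I" "W \<in> I" "Z \<in> I" "W \<noteq> Y" "close a Y X W" "close b Y W Z"
  shows "close (a + b) Y X Z"
proof -
  obtain w where w: "w \<in> proj Y W" using proj_verts assms by blast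
  have wf: "wf_graph (G Y)" by (rule wf_G[OF assms(2)])
  have xz: "near1 Y (a + b) x z" if "x \<in> proj Y X" "z \<in> proj Y Z" for x z
    using near_trans[of "G Y" "\<lambda>_. 1" a x w b z] that w assms(6,7) unfolding close_def by blast
  have xx: "near1 Y (a + b) x z" if "x \<in> proj Y X" "z \<in> proj Y X" for x z
    using that assms(6) near_mono[of "G Y" "\<lambda>_. 1" a x z "a + b"] unfolding close_def by simp
  have zz: "near1 Y (a + b) x z" if "x \<in> proj Y Z" "z \<in> proj Y Z" for x z
    using that assms(7) near_mono[of "G Y" "\<lambda>_. 1" b x z "a + b"] unfolding close_def by simp
  show ?thesis
    unfolding close_def using xz xx zz near_sym[OF wf] by blast
qed

lemma not_close_proj_eq:
  assumes "X \<in> I" "Y \<in> I" "Z \<in> I" "X \<noteq> Y" "Y \<noteq> Z" "X \<noteq> Z" "\<not> close \<theta> Y X Z"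
  shows "proj X Y = proj X Z"
proof -
  have "\<not> proj_dist G proj Y X Z \<le> of_nat \<theta>" using proj_dist_le_iff assms by metis
  then show ?thesis using proj_eq[OF assms(1-6)] by simp
qed

end

locale bottleneck_projections = graph_projections I G proj \<theta>
  for I :: "'i set" and G :: "'i \<Rightarrow> ('v, 'e) graph" and proj :: "'i \<Rightarrow> 'i \<Rightarrow> 'v set" and \<theta> :: nat +
  fixes K D :: nat
  assumes K_pos: "0 < K" and K_large: "2 * \<theta> \<le> K"
    and bottleneck: "Y \<in> I \<Longrightarrow> coarse_bottleneck D (G Y) (\<lambda>_. 1)"
begin

text \<open>The paper's \<open>Y\<^sub>K(X, Z)\<close>.\<close>

definition big :: "'i \<Rightarrow> 'i \<Rightarrow> 'i set" where
  "big X Z = {Y \<in> I - {X, Z}. \<not> close K Y X Z}"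

lemma big_sym: "big X Z = big Z X"
  unfolding big_def using close_sym by blast

lemma bigD:
  assumes "Y \<in> big X Z"
  shows "Y \<in> I" "Y \<noteq> X" "Y \<noteq> Z" "\<not> close K Y X Z" "\<not> close \<theta> Y X Z"
  using assms close_mono[of \<theta> Y X Z K] K_large unfolding big_def by auto

lemma finite_big:
  assumes "X \<in> I" "Z \<in> I"
  shows "finite (big X Z)"
proof (rule finite_subset[OF _ proj_finite[OF assms]])
  show "big X Z \<subseteq> {Y \<in> I - {X, Z}. proj_dist G proj Y X Z > of_nat \<theta>}"
  proof
    fix Y assume Y: "Y \<in> big X Z"
    then have "\<not> proj_dist G proj Y X Z \<le> of_nat \<theta>" using proj_dist_le_iff bigD assms by metis
    then show "Y \<in> {Y \<in> I - {X, Z}. proj_dist G proj Y X Z > of_nat \<theta>}" using bigD(1-3)[OF Y] by simp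
  qed
qed

lemma PK_adj_iff: "PK_adj I G proj K X Z \<longleftrightarrow> X \<in> I \<and> Z \<in> I \<and> X \<noteq> Z \<and> big X Z = {}"
proof -
  have "proj_dist G proj Y X Z \<le> of_nat K \<longleftrightarrow> close K Y X Z"
    if "X \<in> I" "Z \<in> I" "Y \<in> I - {X, Z}" for Y
    using proj_dist_le_iff[of X Y Z K] that by auto
  then show ?thesis unfolding PK_adj_def big_def by auto
qed

lemma PK_adj_sym: "PK_adj I G proj K X Z \<Longrightarrow> PK_adj I G proj K Z X"
  using PK_adj_iff big_sym by metis

lemma PK_adj_close:
  assumes "PK_adj I G proj K X Z" "Y \<in> I" "Y \<noteq> X" "Y \<noteq> Z"
  shows "close K Y X Z"
proof -
  have "Y \<notin> big X Z" using assms(1) by (simp add: PK_adj_iff)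
  with assms(2-4) show ?thesis by (simp add: big_def)
qed

lemma big_proj_eq:
  assumes "X \<in> I" "Z \<in> I" "X \<noteq> Z" "Y \<in> big X Z"
  shows "proj X Y = proj X Z" "proj Z Y = proj Z X"
  using not_close_proj_eq[of X Y Z] not_close_proj_eq[of Z Y X] bigD[OF assms(4)] assms(1-3) close_sym
  by metis+

lemma big_proj_neq:
  assumes "X \<in> I" "Z \<in> I" "Y \<in> big X Z"
  shows "proj Y X \<noteq> proj Y Z"
proof
  assume "proj Y X = proj Y Z"
  then have "close \<theta> Y X Z" using close_refl[of X Y] close_cong bigD[OF assms(3)] assms(1) by metis
  with bigD(5)[OF assms(3)] show False by blast
qed

lemma big_between:
  assumes "X \<in> I" "Z \<in> I" "X \<noteq> Z" "U \<in> big X Z" "V \<in> big X U"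
  shows "V \<noteq> Z" "proj V U = proj V Z" "V \<in> big X Z"
proof -
  note U = bigD[OF assms(4)] and V = bigD[OF assms(5)]
  note e1 = big_proj_eq[OF assms(1-4)]
  note e2 = big_proj_eq[OF assms(1) U(1) U(2)[symmetric] assms(5)]
  show "V \<noteq> Z" using big_proj_neq[OF assms(1) U(1) assms(5)] e1 by metis
  have "\<not> close \<theta> U V Z" using U(5) close_cong[OF e2(2) refl] by metis
  then show e3: "proj V U = proj V Z"
    using not_close_proj_eq[of V U Z] V U assms(2) \<open>V \<noteq> Z\<close> by blast
  have "\<not> close K V X Z" using V(4) close_cong[OF refl e3] by metis
  then show "V \<in> big X Z" using V \<open>V \<noteq> Z\<close> by (simp add: big_def)
qed

lemma big_between':
  assumes "X \<in> I" "Z \<in> I" "X \<noteq> Z" "U \<in> big X Z" "V \<in> big U Z"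
  shows "V \<noteq> X" "proj V U = proj V X" "V \<in> big X Z"
proof -
  have "U \<in> big Z X" "V \<in> big Z U" using assms(4,5) big_sym by blast+
  note b = big_between[OF assms(2,1) assms(3)[symmetric] this]
  from b(1,2) show "V \<noteq> X" "proj V U = proj V X" .
  from b(3) show "V \<in> big X Z" using big_sym by blast
qed

lemma proj_eq_of_adj:
  assumes "W \<in> I" "Y \<in> I" "W \<noteq> Y" "U \<in> big W Y" "V \<in> big W U"
    and "PK_adj I G proj K W W'" "W' \<noteq> Y"
  shows "proj Y W' = proj Y W"
proof (rule ccontr)
  assume neq: "proj Y W' \<noteq> proj Y W"
  have W': "W' \<in> I" using assms(6) by (simp add: PK_adj_iff)
  note U = bigD[OF assms(4)]
  note VY = big_between[OF assms(1-5)]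
  note V = bigD[OF assms(5)]
  have eU: "proj Y U = proj Y W" by (rule big_proj_eq(2)[OF assms(1-4)])
  have eV: "proj Y V = proj Y W" by (rule big_proj_eq(2)[OF assms(1-3) VY(3)])
  have eUV: "proj U V = proj U W"
    by (rule big_proj_eq(2)[OF assms(1) U(1) U(2)[symmetric] assms(5)])
  have "W' \<noteq> U" "W' \<noteq> V" using neq eU eV by auto
  have "close \<theta> U Y W'"
    using not_close_proj_eq[of Y U W'] assms(2,7) U W' \<open>W' \<noteq> U\<close> neq eU by metis
  have "\<not> close \<theta> U W W'"
  proof
    assume "close \<theta> U W W'"
    then have "close (\<theta> + \<theta>) U W Y"
      using close_trans[of W U W' Y \<theta> \<theta>] \<open>close \<theta> U Y W'\<close> close_sym assms(1,2) U(1) W' \<open>W' \<noteq> U\<close> by metis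
    then show False using close_mono[of "\<theta> + \<theta>" U W Y K] U(4) K_large by simp
  qed
  then have "\<not> close \<theta> U V W'" using close_cong[OF eUV refl] by metis
  then have "proj V U = proj V W'"
    using not_close_proj_eq[of V U W'] V U W' \<open>W' \<noteq> U\<close> \<open>W' \<noteq> V\<close> by metis
  then have "\<not> close K V W W'" using V(4) close_cong[OF refl, of V U W' K W] by metis
  then show False
    using PK_adj_close[OF assms(6) V(1,2)] \<open>W' \<noteq> V\<close> by blast
qed

section \<open>The quasi-tree of metric spaces\<close>

abbreviation C :: "('i \<times> 'v, ('i \<times> 'e) + ('i \<times> 'v) set) graph" where
  "C \<equiv> CK I G proj K"

definition clen :: "('i \<times> 'e) + ('i \<times> 'v) set \<Rightarrow> nat" where
  "clen = case_sum (\<lambda>_. 1) (\<lambda>_. K)"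

abbreviation nearC :: "nat \<Rightarrow> 'i \<times> 'v \<Rightarrow> 'i \<times> 'v \<Rightarrow> bool" where
  "nearC \<equiv> near C clen"

lemma C_simps:
  "verts C = (SIGMA Y:I. verts (G Y))"
  "edges C = Inl ` (SIGMA Y:I. edges (G Y)) \<union>
    {Inr {(X, x), (Y, y)} | X Y x y. PK_adj I G proj K X Y \<and> x \<in> proj X Y \<and> y \<in> proj Y X}"
  "ends C (Inl (Y, e)) = map_prod (Pair Y) (Pair Y) (ends (G Y) e)"
  by (simp_all add: CK_def)

lemma ends_C_Inr: "ends C (Inr {a, b}) = (a, b) \<or> ends C (Inr {a, b}) = (b, a)"
proof -
  have "{a, b} = {fst (ends C (Inr {a, b})), snd (ends C (Inr {a, b}))}"
    unfolding CK_def using someI[of "\<lambda>p. {a, b} = {fst p, snd p}" "(a, b)"] by simp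
  then show ?thesis by (metis doubleton_eq_iff prod.collapse)
qed

definition cross :: "'i \<times> 'v \<Rightarrow> 'i \<times> 'v \<Rightarrow> bool" where
  "cross a b \<longleftrightarrow> PK_adj I G proj K (fst a) (fst b) \<and> snd a \<in> proj (fst a) (fst b) \<and> snd b \<in> proj (fst b) (fst a)"

lemma cross_sym: "cross a b \<Longrightarrow> cross b a"
  unfolding cross_def using PK_adj_sym by blast

lemma edges_C_cases:
  assumes "e \<in> edges C"
  obtains Y f where "Y \<in> I" "f \<in> edges (G Y)" "e = Inl (Y, f)"
  | a b where "cross a b" "e = Inr {a, b}"
proof -
  consider "e \<in> Inl ` (SIGMA Y:I. edges (G Y))"
    | X x Y y where "e = Inr {(X, x), (Y, y)}" "PK_adj I G proj K X Y" "x \<in> proj X Y" "y \<in> proj Y X"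
    using assms unfolding C_simps by blast
  then show ?thesis
  proof cases
    case 1
    then show ?thesis using that(1) by auto
  next
    case 2
    then have "cross (X, x) (Y, y)" by (simp add: cross_def)
    with 2 that(2) show ?thesis by blast
  qed
qed

lemma cross_in_verts: "cross a b \<Longrightarrow> a \<in> verts C \<and> b \<in> verts C"
  unfolding cross_def PK_adj_iff C_simps using proj_in_verts by (cases a; cases b) auto

lemma wf_C: "wf_graph C"
  unfolding wf_graph_def
proof
  fix e assume "e \<in> edges C"
  then show "ends C e \<in> verts C \<times> verts C"
  proof (cases rule: edges_C_cases)
    case (1 Y f)
    then have "ends (G Y) f \<in> verts (G Y) \<times> verts (G Y)"
      using wf_G unfolding wf_graph_def by blast
    then show ?thesis using 1 by (auto simp: C_simps(1,3))
  next
    case (2 a b)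
    then show ?thesis using cross_in_verts[OF 2(1)] ends_C_Inr[of a b] by auto
  qed
qed

lemma clen_bounds: "e \<in> edges C \<Longrightarrow> 1 \<le> clen e \<and> clen e \<le> K"
  using K_pos by (cases e) (auto simp: clen_def)

lemma adj_C_cases:
  assumes "adj C a b"
  obtains "fst a \<in> I" "fst b = fst a" "adj (G (fst a)) (snd a) (snd b)" | "cross a b"
proof -
  obtain e where e: "e \<in> edges C" "ends C e = (a, b) \<or> ends C e = (b, a)"
    using assms unfolding adj_def by blast
  from e(1) show ?thesis
  proof (cases rule: edges_C_cases)
    case (1 Y f)
    obtain x y where xy: "ends (G Y) f = (x, y)" by (cases "ends (G Y) f")
    have "adj (G Y) x y" "adj (G Y) y x" using 1 xy by (auto simp: adj_def)
    then show ?thesis using that(1) e(2) 1 xy by (auto simp: C_simps(3))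
  next
    case (2 c d)
    then have "{a, b} = {c, d}" using e(2) ends_C_Inr[of c d] by auto
    then show ?thesis using that(2) 2(1) cross_sym by (metis doubleton_eq_iff)
  qed
qed

lemma cross_edge:
  assumes "cross a b"
  shows "adj C a b" "nearC K a b"
proof -
  have e: "Inr {a, b} \<in> edges C"
    using assms unfolding cross_def C_simps by (cases a; cases b) auto
  then show "adj C a b" using ends_C_Inr[of a b] unfolding adj_def by blast
  show "nearC K a b" using near_edge[OF wf_C e ends_C_Inr, of clen] by (simp add: clen_def)
qed

lemma inner_edge:
  assumes "Y \<in> I" "e \<in> edges (G Y)" "ends (G Y) e = (x, y) \<or> ends (G Y) e = (y, x)"
  shows "Inl (Y, e) \<in> edges C"
    "ends C (Inl (Y, e)) = ((Y, x), (Y, y)) \<or> ends C (Inl (Y, e)) = ((Y, y), (Y, x))"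
  using assms by (auto simp: C_simps(2,3))

lemma near_inner:
  assumes "Y \<in> I" "near1 Y n x y"
  shows "nearC n (Y, x) (Y, y)"
proof -
  have w: "walk C (Y, x) (map (\<lambda>e. Inl (Y, e)) w) (Y, y)" if "walk (G Y) x w y" for w
    using that
  proof (induction w arbitrary: x)
    case Nil
    then show ?case using assms(1) by (auto simp: C_simps(1))
  next
    case (Cons e w)
    then obtain x' where e: "e \<in> edges (G Y)" "ends (G Y) e = (x, x') \<or> ends (G Y) e = (x', x)"
      and w: "walk (G Y) x' w y" by auto
    show ?case unfolding list.map walk.simps using inner_edge[OF assms(1) e] Cons.IH[OF w] by blast
  qed
  have l: "map clen (map (\<lambda>e. Inl (Y, e)) w) = map (\<lambda>_. 1) w" for w
    by (simp add: clen_def)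
  obtain w where "walk (G Y) x w y" "sum_list (map (\<lambda>_. 1) w) \<le> n"
    using assms(2) unfolding near_def by blast
  then show ?thesis unfolding near_def using w l by metis
qed

lemma joined_inner:
  assumes "joined (G Y) A x y" "Y \<in> I"
  shows "joined C (Pair Y ` A) (Y, x) (Y, y)"
  using assms(1)
proof (induction rule: joined.induct)
  case joined_refl
  then show ?case by (auto intro: joined.joined_refl)
next
  case (joined_step v w)
  then have "adj C (Y, v) (Y, w)"
    unfolding adj_def using inner_edge[OF assms(2)] by metis
  with joined_step show ?case by (auto intro: joined.joined_step)
qed

definition pr :: "'i \<Rightarrow> 'i \<times> 'v \<Rightarrow> 'v set" where
  "pr Y a = (if fst a = Y then {snd a} else proj Y (fst a))"

lemma pr_in_verts: "Y \<in> I \<Longrightarrow> a \<in> verts C \<Longrightarrow> y \<in> pr Y a \<Longrightarrow> y \<in> verts (G Y)"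
  using proj_in_verts by (auto simp: pr_def C_simps(1) split: if_splits)

lemma pr_near:
  assumes "Y \<in> I" "a \<in> verts C" "y \<in> pr Y a" "y' \<in> pr Y a"
  shows "near1 Y K y y'"
proof (cases "fst a = Y")
  case True
  then show ?thesis using assms pr_in_verts[OF assms(1-3)] by (auto simp: pr_def near_refl)
next
  case False
  then have "close \<theta> Y (fst a) (fst a)" using close_refl assms by (auto simp: C_simps(1))
  then have "close K Y (fst a) (fst a)" by (rule close_mono) (use K_large in simp)
  then show ?thesis using False assms by (simp add: pr_def close_def)
qed

lemma pr_adj_near:
  assumes "Y \<in> I" "adj C a b" "y \<in> pr Y a" "y' \<in> pr Y b"
  shows "near1 Y K y y'"
  using assms(2)
proof (cases rule: adj_C_cases)
  case 1
  show ?thesis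
  proof (cases "fst a = Y")
    case True
    then obtain e where e: "e \<in> edges (G Y)" "ends (G Y) e = (y, y') \<or> ends (G Y) e = (y', y)"
      using 1 assms(3,4) by (auto simp: pr_def adj_def)
    have "near1 Y 1 y y'" using near_edge[OF wf_G[OF assms(1)] e, of "\<lambda>_. 1"] by simp
    then show ?thesis by (rule near_mono) (use K_pos in simp)
  next
    case False
    then have "pr Y b = pr Y a" using 1 by (simp add: pr_def)
    then show ?thesis using pr_near adj_in_verts[OF wf_C assms(2)] assms by blast
  qed
next
  case 2
  have v: "a \<in> verts C" "b \<in> verts C" using cross_in_verts[OF 2] by auto
  have ne: "fst a \<noteq> fst b" using 2 by (simp add: cross_def PK_adj_iff)
  consider "fst a = Y" | "fst b = Y" | "fst a \<noteq> Y" "fst b \<noteq> Y" by blast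
  then show ?thesis
  proof cases
    case 1
    then have "y \<in> pr Y b" using 2 assms(3) ne by (auto simp: pr_def cross_def)
    then show ?thesis using pr_near v assms by blast
  next
    case b: 2
    then have "y' \<in> pr Y a" using 2 assms(4) ne by (auto simp: pr_def cross_def)
    then show ?thesis using pr_near v assms by blast
  next
    case 3
    then have "close K Y (fst a) (fst b)" using PK_adj_close 2 assms(1) by (auto simp: cross_def)
    then show ?thesis using 3 assms by (simp add: pr_def close_def)
  qed
qed

text \<open>At most one space separates \<open>fst a\<close> from \<open>Y\<close>, by \<open>proj_eq_of_adj\<close>, and the
  projections of \<open>fst a\<close> and \<open>Y\<close> to it are close.\<close>

lemma near_where_pr_changes:
  assumes Y: "Y \<in> I" and adj: "adj C a b" and neq: "pr Y a \<noteq> pr Y b" and y: "y \<in> pr Y a"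
  shows "nearC (4 * K) a (Y, y)"
proof -
  obtain W w where a: "a = (W, w)" by (cases a)
  obtain W' w' where b: "b = (W', w')" by (cases b)
  have av: "a \<in> verts C" using adj_in_verts[OF wf_C adj] by blast
  have W: "W \<in> I" "w \<in> verts (G W)" using av a by (auto simp: C_simps(1))
  show ?thesis
  proof (cases "W = Y")
    case True
    then have "a = (Y, y)" using y a by (simp add: pr_def)
    then show ?thesis using near_refl av by metis
  next
    case WY: False
    have cr: "cross a b"
      using adj
    proof (cases rule: adj_C_cases)
      case 1
      then show ?thesis using neq a WY by (simp add: pr_def)
    qed
    then have W': "PK_adj I G proj K W W'" "W \<noteq> W'" "W' \<in> I" "w \<in> proj W W'"
      using a b by (auto simp: cross_def PK_adj_iff)
    have yW: "y \<in> proj Y W" using y a WY by (simp add: pr_def)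
    show ?thesis
    proof (cases "W' = Y")
      case True
      then have "cross a (Y, y)" using W' yW a by (simp add: cross_def)
      from cross_edge(2)[OF this] show ?thesis by (rule near_mono) simp
    next
      case W'Y: False
      have pneq: "proj Y W' \<noteq> proj Y W" using neq a b WY W'Y by (simp add: pr_def)
      have cl: "close \<theta> W W' Y"
        using not_close_proj_eq[of Y W W'] Y W W' WY W'Y pneq close_sym by metis
      obtain w1 where w1: "w1 \<in> proj W Y" using proj_verts[of Y W] Y W WY by blast
      have "near1 W \<theta> w w1" using cl W'(4) w1 by (simp add: close_def)
      then have n1: "nearC \<theta> a (W, w1)" using near_inner W a by blast
      show ?thesis
      proof (cases "PK_adj I G proj K W Y")
        case True
        then have "cross (W, w1) (Y, y)" using w1 yW by (simp add: cross_def)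
        from near_trans[OF n1 cross_edge(2)[OF this]] show ?thesis
          by (rule near_mono) (use K_large in simp)
      next
        case False
        then obtain U where U: "U \<in> big W Y" using PK_adj_iff W Y WY by blast
        note bU = bigD[OF U] and eU = big_proj_eq[OF W(1) Y WY U]
        have "big W U = {}" using proj_eq_of_adj[OF W(1) Y WY U _ W'(1) W'Y] pneq by blast
        then have adjWU: "PK_adj I G proj K W U" using PK_adj_iff W bU by blast
        have "big U Y = {}"
        proof (rule ccontr)
          assume "big U Y \<noteq> {}"
          then obtain V where V: "V \<in> big U Y" by blast
          note bV = bigD[OF V] and VW = big_between'[OF W(1) Y WY U V]
          have "proj U V = proj U Y" by (rule big_proj_eq(1)[OF bU(1) Y bU(3) V])
          then have "\<not> close K U W V" using bU(4) close_cong[OF refl] by metis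
          then have "U \<in> big W V" using bU bV by (auto simp: big_def)
          then show False using proj_eq_of_adj[OF W(1) Y WY VW(3) _ W'(1) W'Y] pneq by blast
        qed
        then have adjUY: "PK_adj I G proj K U Y" using PK_adj_iff Y bU by blast
        have W'U: "W' \<noteq> U" using pneq eU(2) by blast
        have "close \<theta> U W' Y"
          using not_close_proj_eq[of Y U W'] Y bU W' W'U W'Y pneq eU(2) close_sym by metis
        moreover have "close K U W W'" using PK_adj_close[OF W'(1) bU(1,2)] W'U by blast
        ultimately have clU: "close (K + \<theta>) U W Y"
          using close_trans[of W U W' Y] W Y bU(1) W'(3) W'U by blast
        obtain u1 u2 where u: "u1 \<in> proj U W" "u2 \<in> proj U Y"
          using proj_verts[of W U] proj_verts[of Y U] W Y bU by blast
        have "near1 U (K + \<theta>) u1 u2" using clU u by (simp add: close_def)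
        then have n3: "nearC (K + \<theta>) (U, u1) (U, u2)" using near_inner bU by blast
        have "cross (W, w1) (U, u1)" using adjWU w1 u eU(1) by (simp add: cross_def)
        then have n2: "nearC K (W, w1) (U, u1)" by (rule cross_edge)
        have "cross (U, u2) (Y, y)" using adjUY yW u eU(2) by (simp add: cross_def)
        then have n4: "nearC K (U, u2) (Y, y)" by (rule cross_edge)
        from near_trans[OF n1 near_trans[OF n2 near_trans[OF n3 n4]]] show ?thesis
          by (rule near_mono) (use K_large in simp)
      qed
    qed
  qed
qed

definition unavoidable :: "'i \<times> 'v \<Rightarrow> 'i \<times> 'v \<Rightarrow> ('i \<times> 'v) set" where
  "unavoidable a b = {v. \<forall>A. joined C A a b \<longrightarrow> (\<exists>u\<in>A. nearC (D + 5 * K) v u)}"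

lemma unavoidable_ends:
  shows "a \<in> verts C \<Longrightarrow> a \<in> unavoidable a b" and "b \<in> verts C \<Longrightarrow> b \<in> unavoidable a b"
  unfolding unavoidable_def by (auto dest: joined_in intro: near_refl)

text \<open>A path from \<open>a\<close> to \<open>b\<close> projects to a coarse path in \<open>Y\<close>, which passes close to each vertex of
  the bottleneck path. The projection being constant away from \<open>Y\<close>, the path itself has to come
  close to the point it is projected to.\<close>

lemma joined_unavoidable_within:
  assumes Y: "Y \<in> I" and ab: "a \<in> verts C" "b \<in> verts C" and neq: "pr Y a \<noteq> pr Y b"
    and x: "x \<in> pr Y a" and z: "z \<in> pr Y b"
  shows "joined C (unavoidable a b) (Y, x) (Y, z)"
proof -
  interpret Y: weighted_graph "G Y" "\<lambda>_. 1" 1 by (rule weighted[OF Y])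
  have v: "x \<in> verts (G Y)" "z \<in> verts (G Y)" using pr_in_verts Y ab x z by auto
  obtain S where S: "joined (G Y) S x z"
    "\<And>s A. s \<in> S \<Longrightarrow> joined (G Y) A x z \<Longrightarrow> \<exists>y\<in>A. near1 Y D s y"
    using bottleneck[OF Y] v unfolding coarse_bottleneck_def by metis
  have "(Y, s) \<in> unavoidable a b" if s: "s \<in> S" for s
    unfolding unavoidable_def
  proof (intro CollectI allI impI)
    fix A assume A: "joined C A a b"
    define A' where "A' = {y \<in> verts (G Y). \<exists>u y'. joined C A a u \<and> y' \<in> pr Y u \<and> near1 Y K y y'}"
    have ball: "joined (G Y) A' y0 y"
      if "joined C A a u" "y \<in> pr Y u" "near1 Y K y0 y" "y0 \<in> verts (G Y)" for u y y0
    proof (rule Y.joined_ball[OF that(3,4)])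
      have "u \<in> verts C" by (rule joined_in_verts[OF that(1) wf_C ab(1)])
      then show "y \<in> verts (G Y)" using pr_in_verts Y that(2) by blast
      show "w \<in> A'" if "w \<in> verts (G Y)" "near1 Y K w y" for w
        using that \<open>joined C A a u\<close> \<open>y \<in> pr Y u\<close> unfolding A'_def by blast
    qed
    have proj_path: "\<forall>y\<in>pr Y u. joined (G Y) A' x y" if "joined C A a u" for u
      using that
    proof (induction rule: joined.induct)
      case joined_refl
      then show ?case
        using ball[OF joined.joined_refl] pr_near[OF Y ab(1) x] v(1) by blast
    next
      case (joined_step u u')
      have uv: "u \<in> verts C" using joined_in_verts[OF joined_step(1) wf_C ab(1)] .
      have "\<exists>y0. y0 \<in> pr Y u"
        using proj_verts[of "fst u" Y] Y uv by (auto simp: pr_def C_simps(1))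
      then obtain y0 where y0: "y0 \<in> pr Y u" ..
      have "y0 \<in> verts (G Y)" by (rule pr_in_verts[OF Y uv y0])
      then have "joined (G Y) A' y0 y" if "y \<in> pr Y u'" for y
        using ball[OF joined.joined_step[OF joined_step(1-3)] that] pr_adj_near[OF Y joined_step(2) y0 that]
        by blast
      then show ?case using joined_step.IH y0 joined_trans by metis
    qed
    then have "joined (G Y) A' x z" using A z by blast
    from S(2)[OF s this] obtain y u y' where y: "near1 Y D s y" "near1 Y K y y'"
      and u: "joined C A a u" "y' \<in> pr Y u" unfolding A'_def by blast
    have sy': "nearC (D + K) (Y, s) (Y, y')" by (rule near_inner[OF Y near_trans[OF y]])
    have ub: "joined C A u b" by (rule joined_trans[OF A joined_sym[OF u(1)]])
    have "\<exists>c\<in>A. \<exists>d. adj C c d \<and> pr Y c = pr Y u \<and> pr Y d \<noteq> pr Y u"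
    proof (cases "pr Y a = pr Y u")
      case True
      then show ?thesis using joined_leaves[OF ub, of "\<lambda>c. pr Y c = pr Y u"] neq by simp
    next
      case False
      then show ?thesis using joined_leaves[OF joined_sym[OF u(1)], of "\<lambda>c. pr Y c = pr Y u"] by simp
    qed
    then obtain c d where c: "c \<in> A" "adj C c d" "pr Y c = pr Y u" "pr Y d \<noteq> pr Y u" by blast
    have "nearC (4 * K) c (Y, y')"
      using near_where_pr_changes[OF Y c(2)] c(3,4) u(2) by metis
    from near_trans[OF sy' near_sym[OF wf_C this]] have "nearC (D + 5 * K) (Y, s) c"
      by (rule near_mono) simp
    with c(1) show "\<exists>u\<in>A. nearC (D + 5 * K) (Y, s) u" by blast
  qed
  then have "Pair Y ` S \<subseteq> unavoidable a b" by blast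
  then show ?thesis by (rule joined_mono[OF joined_inner[OF S(1) Y]])
qed

lemma joined_unavoidable_between:
  assumes ab: "a \<in> verts C" "b \<in> verts C" and XZ: "X \<in> I" "Z \<in> I" "X \<noteq> Z"
    and big: "\<And>W. W \<in> big X Z \<Longrightarrow> W \<noteq> fst a \<and> W \<noteq> fst b \<and> proj W X = proj W (fst a) \<and> proj W Z = proj W (fst b)"
    and xz: "x \<in> proj X Z" "z \<in> proj Z X" "(X, x) \<in> unavoidable a b" "(Z, z) \<in> unavoidable a b"
  shows "joined C (unavoidable a b) (X, x) (Z, z)"
  using XZ big xz
proof (induction "card (big X Z)" arbitrary: X Z x z rule: less_induct)
  case less
  note XZ = less.prems(1-3)
  show ?case
  proof (cases "big X Z = {}")
    case True
    then have "cross (X, x) (Z, z)" using less.prems by (simp add: cross_def PK_adj_iff)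
    then show ?thesis using joined_edge[OF less.prems(7,8)] cross_edge(1) by blast
  next
    case False
    then obtain Y where Y: "Y \<in> big X Z" by blast
    note bY = bigD[OF Y] and eY = big_proj_eq[OF XZ Y]
    obtain y y' where y: "y \<in> proj Y X" "y' \<in> proj Y Z"
      using proj_verts[of X Y] proj_verts[of Z Y] XZ bY by blast
    have "pr Y a = proj Y X" "pr Y b = proj Y Z" using less.prems(4)[OF Y] by (auto simp: pr_def)
    then have yy': "joined C (unavoidable a b) (Y, y) (Y, y')"
      using joined_unavoidable_within[OF bY(1) ab] big_proj_neq[OF XZ(1,2) Y] y by simp
    then have yu: "(Y, y) \<in> unavoidable a b" "(Y, y') \<in> unavoidable a b" using joined_in by metis+
    have XY: "big X Y \<subset> big X Z" using big_between(3)[OF XZ Y] Y bigD(3)[of Y X Y] by blast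
    have YZ: "big Y Z \<subset> big X Z" using big_between'(3)[OF XZ Y] Y bigD(2)[of Y Y Z] by blast
    have fin: "finite (big X Z)" by (rule finite_big[OF XZ(1,2)])
    have "joined C (unavoidable a b) (X, x) (Y, y)"
    proof (rule less.hyps[OF psubset_card_mono[OF fin XY] XZ(1) bY(1) bY(2)[symmetric]])
      show "W \<noteq> fst a \<and> W \<noteq> fst b \<and> proj W X = proj W (fst a) \<and> proj W Y = proj W (fst b)"
        if "W \<in> big X Y" for W
        using big_between[OF XZ Y that] less.prems(4) by simp
    qed (use less.prems y yu eY in auto)
    moreover have "joined C (unavoidable a b) (Y, y') (Z, z)"
    proof (rule less.hyps[OF psubset_card_mono[OF fin YZ] bY(1) XZ(2) bY(3)])
      show "W \<noteq> fst a \<and> W \<noteq> fst b \<and> proj W Y = proj W (fst a) \<and> proj W Z = proj W (fst b)"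
        if "W \<in> big Y Z" for W
        using big_between'[OF XZ Y that] less.prems(4) by simp
    qed (use less.prems y yu eY in auto)
    ultimately show ?thesis using yy' joined_trans by metis
  qed
qed

lemma joined_unavoidable:
  assumes ab: "a \<in> verts C" "b \<in> verts C"
  shows "joined C (unavoidable a b) a b"
proof (cases "a = b")
  case True
  then show ?thesis using joined_refl unavoidable_ends ab by metis
next
  case False
  obtain X x Z z where e: "a = (X, x)" "b = (Z, z)" by (cases a; cases b)
  have v: "X \<in> I" "Z \<in> I" using ab e by (auto simp: C_simps(1))
  show ?thesis
  proof (cases "X = Z")
    case True
    then show ?thesis
      using joined_unavoidable_within[OF v(1) ab, of x z] False e by (simp add: pr_def)
  next
    case XZ: False
    obtain x' z' where x': "x' \<in> proj X Z" and z': "z' \<in> proj Z X"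
      using proj_verts v XZ by blast
    have 1: "joined C (unavoidable a b) a (X, x')"
    proof (cases "pr X a = pr X b")
      case True
      then have "x' = x" using x' e XZ by (auto simp: pr_def)
      then show ?thesis using joined_refl unavoidable_ends(1)[OF ab(1)] e by metis
    next
      case False
      then show ?thesis
        using joined_unavoidable_within[OF v(1) ab False, of x x'] x' e XZ by (simp add: pr_def)
    qed
    have 2: "joined C (unavoidable a b) (Z, z') b"
    proof (cases "pr Z a = pr Z b")
      case True
      then have "z' = z" using z' e XZ by (auto simp: pr_def)
      then show ?thesis using joined_refl unavoidable_ends(2)[OF ab(2)] e by metis
    next
      case False
      then show ?thesis
        using joined_unavoidable_within[OF v(2) ab False, of z' z] z' e XZ by (simp add: pr_def)
    qed
    have "joined C (unavoidable a b) (X, x') (Z, z')"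
      by (rule joined_unavoidable_between[OF ab v XZ _ x' z'])
        (use bigD joined_in[OF 1] joined_in[OF 2] e in auto)
    then show ?thesis using 1 2 joined_trans by metis
  qed
qed

lemma coarse_bottleneck_C: "coarse_bottleneck (D + 5 * K) C clen"
  unfolding coarse_bottleneck_def
proof (intro ballI exI conjI allI impI)
  fix a b assume "a \<in> verts C" "b \<in> verts C"
  then show "joined C (unavoidable a b) a b" by (rule joined_unavoidable)
  show "\<exists>u\<in>A. nearC (D + 5 * K) v u" if "v \<in> unavoidable a b" "joined C A a b" for v A
    using that unfolding unavoidable_def by blast
qed

lemma connected_C: "connected_graph C"
  unfolding connected_graph_def
  using wf_C joined_imp_walk[OF joined_unavoidable _ wf_C] by blast

end

theorem theorem6p6:
  fixes I :: "'i set"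
    and G :: "'i \<Rightarrow> ('v, 'e) graph"
    and proj :: "'i \<Rightarrow> 'i \<Rightarrow> 'v set"
    and \<theta> K :: nat
    and D :: real
  assumes "graph_projections I G proj \<theta>"
    and "K > 0"
    and "K \<ge> 4 * \<theta>"
    and "D \<ge> 0"
    and "\<And>Y. Y \<in> I \<Longrightarrow> bottleneck D (G Y)"
  shows "quasi_tree (points (CK I G proj K) (CK_len K)) (path_dist (CK I G proj K) (CK_len K))"
proof -
  interpret graph_projections I G proj \<theta> by fact
  have "bottleneck_projections I G proj \<theta> K (nat \<lceil>D\<rceil>)"
  proof unfold_locales
    show "coarse_bottleneck (nat \<lceil>D\<rceil>) (G Y) (\<lambda>_. 1)" if "Y \<in> I" for Y
      by (rule bottleneck_imp_coarse_bottleneck[OF connected assms(5)]) 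
        (use that real_nat_ceiling_ge in auto)
  qed (use assms(2,3) in simp_all)
  then interpret bottleneck_projections I G proj \<theta> K "nat \<lceil>D\<rceil>" .
  interpret C: weighted_graph C clen K
    by unfold_locales (use connected_C clen_bounds in auto)
  have "CK_len K = C.len"
    by (auto simp: CK_len_def clen_def fun_eq_iff split: sum.split)
  then show ?thesis using C.coarse_bottleneck_imp_quasi_tree[OF coarse_bottleneck_C] by simp
qed

end
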